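(* For $N\ge12$ let $Z_{F,N}(s)=\sum_{n=1}^NF_n^{-s}$. For every integer $N\ge12$ there is a unique $\sigma_N\in(1/2,3/4)$ satisfying $$Z_{F,N}(\sigma_N)=4+2\cdot144^{-\sigma_N}.$$ If $\mathcal R_{F,N}^{+}:=\{\operatorname{Re}\rho: Z_{F,N}(\rho)=0,\ \operatorname{Re}\rho>0\}$, then $$\overline{\mathcal R_{F,N}^{+}}=[0,\sigma_N].$$ In particular, $\sup\mathcal R_{F,N}^{+}=\sigma_N$, and no zero of $Z_{F,N}$ lies on the line $\operatorname{Re}s=\sigma_N$. Moreover $\sigma_N\nearrow\sigma_F$ as $N\to\infty$ (that is, $\sigma_N$ is increasing in $N$ with limit $\sigma_F$).
   Context: $F_1=F_2=1$, $F_{n+2}=F_{n+1}+F_n$ are the Fibonacci numbers, and $Z_F(s)=\sum_{n\ge1}F_n^{-s}$ for $\operatorname{Re}s>0$. $\sigma_F=0.7431\ldots$ is the unique number in $(0.7,0.75)$ with $Z_F(\sigma_F)=4+2\cdot144^{-\sigma_F}$. The overline denotes closure in $\mathbb R$. *)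

theory Defs
  imports "HOL-Number_Theory.Fib" "HOL-Analysis.Analysis"
begin

definition Z_FN :: "nat \<Rightarrow> complex \<Rightarrow> complex" where
  "Z_FN N s = (\<Sum>n=1..N. of_nat (fib n) powr (- s))"

text \<open>The index is shifted because the series starts at n = 1; it converges for \<open>Re s > 0\<close>,
  the only range where the definition is meaningful.\<close>

definition Z_F :: "complex \<Rightarrow> complex" where
  "Z_F s = (\<Sum>n. of_nat (fib (Suc n)) powr (- s))"

definition sigma_F :: real where
  "sigma_F = (THE \<sigma>. \<sigma> \<in> {7/10<..<3/4} \<and>
     Z_F (of_real \<sigma>) = 4 + 2 * 144 powr (- of_real \<sigma>))"

definition sigma_FN :: "nat \<Rightarrow> real" where
  "sigma_FN N = (THE \<sigma>. \<sigma> \<in> {1/2<..<3/4} \<and>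
     Z_FN N (of_real \<sigma>) = 4 + 2 * 144 powr (- of_real \<sigma>))"

definition R_FN :: "nat \<Rightarrow> real set" where
  "R_FN N = {Re \<rho> | \<rho>. Z_FN N \<rho> = 0 \<and> Re \<rho> > 0}"

end

theory Submission
  imports Defs "HOL-Number_Theory.Number_Theory" "HOL-Complex_Analysis.Complex_Analysis"
begin

text \<open>
  By Carmichael's theorem every \<open>F\<^sub>n\<close> with \<open>n \<noteq> 1, 2, 6, 12\<close> has a prime divisor that divides no
  earlier Fibonacci number, so the numbers \<open>ln F\<^sub>n\<close> for these \<open>n\<close> are linearly independent over
  the integers, while \<open>F\<^sub>6 = 2\<^sup>3\<close> and \<open>F\<^sub>1\<^sub>2 = 2\<^sup>4 3\<^sup>2\<close>. By Kronecker's theorem the vertical translates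
  of \<open>Z\<^sub>F\<^sub>,\<^sub>N\<close> approximate every twist of the sum by unimodular phases obeying these two relations.
  On the line \<open>Re s = \<sigma>\<close> with \<open>\<sigma> < \<sigma>\<^sub>N\<close> the phases can be chosen to make the twisted sum vanish
  at \<open>\<sigma>\<close>, and Hurwitz's theorem yields zeros of \<open>Z\<^sub>F\<^sub>,\<^sub>N\<close> nearby. For \<open>\<sigma> \<ge> \<sigma>\<^sub>N\<close> the real part of the sum is
  smallest when all free phases are \<open>-1\<close>, where it is \<open>4 + 2 \<cdot> 144\<^sup>-\<^sup>\<sigma> - Z\<^sub>F\<^sub>,\<^sub>N(\<sigma>) \<ge> 0\<close>; on the boundary
  line it is not attained because \<open>5\<^sup>i\<^sup>t = 13\<^sup>i\<^sup>t = -1\<close> is impossible.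
\<close>

section \<open>Primitive prime divisors of Fibonacci numbers\<close>

text \<open>Carmichael's theorem is obtained by a size argument. If F_n has no primitive prime, it
  divides 2 rad(n) times the lcm of the F_(n/q), where q runs over the primes dividing n. The
  quotient of F_n by that lcm is the homogeneous cyclotomic value Phi_n(\<alpha>, \<beta>) at the
  golden ratio and its conjugate. Its size is about \<alpha> to the power phi(n), which soon exceeds
  2 rad(n). Two points beyond independence need numerical care. Other phases at 2 and 3 could make
  the term at 144 negative; that this gain never pays rests on \<open>fib_wt_12_trade_off\<close>,
  which holds at 18/25 but fails at 7/10, and therefore \<open>sigma_FN N\<close> is located above
  18/25. And the free terms fill a disc only if the longest of them does not outweigh the others,
  which is \<open>fib_wt_5_le\<close>.\<close>

lemma fib_add_pred:
  assumes "m > 0" "n > 0"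
  shows "fib (m + n) = fib m * fib (n - 1) + fib (m - 1) * fib n + fib m * fib n"
    and "fib (m + n - 1) = fib (m - 1) * fib (n - 1) + fib m * fib n"
proof -
  obtain a where a: "m = Suc a" using assms(1) by (cases m) auto
  obtain b where b: "n = Suc b" using assms(2) by (cases n) auto
  show "fib (m + n - 1) = fib (m - 1) * fib (n - 1) + fib m * fib n"
    using fib_add[of a b] by (simp add: a b algebra_simps)
  show "fib (m + n) = fib m * fib (n - 1) + fib (m - 1) * fib n + fib m * fib n"
    using fib_add[of "Suc a" b] by (simp add: a b algebra_simps)
qed

text \<open>
  Expanding \<open>\<alpha>\<^sup>d = F\<^sub>d \<alpha> + F\<^sub>d\<^sub>-\<^sub>1\<close> to the power \<open>k + 1\<close> modulo the cube of \<open>F\<^sub>d\<close>. The factor \<open>A\<^sup>2\<close>,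
  which is prime to \<open>F\<^sub>d\<close>, keeps the exponents of \<open>A\<close> nonnegative. The second-order term is
  needed for the \<open>p\<close>-adic valuation when \<open>p\<close> divides \<open>F\<^sub>d\<close> exactly once.
\<close>
lemma fib_mult_cong:
  fixes d k :: nat
  defines "x \<equiv> int (fib d)" and "A \<equiv> int (fib (d - 1))"
  assumes "d > 0"
  shows "\<exists>u w. int (fib (Suc k * d)) * A\<^sup>2 =
           int (Suc k) * x * A ^ (k + 2) + int (Suc k choose 2) * x\<^sup>2 * A ^ (k + 1) + x ^ 3 * u
         \<and> int (fib (Suc k * d - 1)) = A ^ Suc k + x\<^sup>2 * w"
proof (induction k)
  case 0
  show ?case by (intro exI[of _ 0]) (simp add: x_def A_def power2_eq_square)
next
  case (Suc k)
  then obtain u w where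
    u: "int (fib (Suc k * d)) * A\<^sup>2 =
           int (Suc k) * x * A ^ (k + 2) + int (Suc k choose 2) * x\<^sup>2 * A ^ (k + 1) + x ^ 3 * u"
    and w: "int (fib (Suc k * d - 1)) = A ^ Suc k + x\<^sup>2 * w" by blast
  define U where "U = int (fib (Suc k * d))"
  define W where "W = int (fib (Suc k * d - 1))"
  have eq: "Suc (Suc k) * d = Suc k * d + d" by simp
  have pos: "Suc k * d > 0" using \<open>d > 0\<close> by simp
  have 1: "int (fib (Suc (Suc k) * d)) = U * A + W * x + U * x"
    unfolding eq fib_add_pred(1)[OF pos \<open>d > 0\<close>] by (simp add: U_def W_def x_def A_def)
  have 2: "int (fib (Suc (Suc k) * d - 1)) = W * A + U * x"
    unfolding eq fib_add_pred(2)[OF pos \<open>d > 0\<close>] by (simp add: U_def W_def x_def A_def)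
  \<comment> \<open>F_d divides F_((k+1)d), so the cross term \<open>U * x\<close> in F_((k+2)d - 1)
    is a multiple of \<open>x\<close> squared.\<close>
  have "x dvd U" unfolding x_def U_def
    by (metis dvd_triv_right fib_gcd gcd_nat.absorb_iff2 gcd_nat.orderI int_dvd_int_iff gcd.commute)
  then obtain v where v: "U = x * v" by auto
  have ch: "int (Suc (Suc k) choose 2) = int (Suc k choose 2) + int (Suc k)"
    by (simp add: numeral_2_eq_2)
  have U': "U * A\<^sup>2 = int (Suc k) * x * A ^ (k + 2) + int (Suc k choose 2) * x\<^sup>2 * A ^ (k + 1) + x ^ 3 * u"
    using u by (simp add: U_def)
  have W': "W = A ^ Suc k + x\<^sup>2 * w" using w by (simp add: W_def)
  have "int (fib (Suc (Suc k) * d)) * A\<^sup>2 = (U * A\<^sup>2) * A + W * x * A\<^sup>2 + (U * A\<^sup>2) * x"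
    unfolding 1 by (simp add: algebra_simps power2_eq_square)
  also have "\<dots> = int (Suc (Suc k)) * x * A ^ (Suc k + 2)
        + int (Suc (Suc k) choose 2) * x\<^sup>2 * A ^ (Suc k + 1)
        + x ^ 3 * (u * A + w * A\<^sup>2 + int (Suc k choose 2) * A ^ (k + 1) + x * u)"
    unfolding U' W' ch by (simp add: algebra_simps power2_eq_square power3_eq_cube)
  finally have "int (fib (Suc (Suc k) * d)) * A\<^sup>2 = \<dots>" .
  moreover have "int (fib (Suc (Suc k) * d - 1)) = A ^ Suc (Suc k) + x\<^sup>2 * (w * A + v)"
    unfolding 2 W' unfolding v by (simp add: algebra_simps power2_eq_square)
  ultimately show ?case by blast
qed

text \<open>Let r = F_(qd) / F_d. Modulo x^2 the expansion gives r A^2 = q A^(q+1) + C(q,2) x A^q,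
  and p divides x but not A. So r is prime to p if q differs from p, and p^2 does not divide r if p
  = q is odd, since then p divides C(q,2). The factor 2 in \<open>2 * q\<close> allows for p = q =
  2, as in F_6 / F_3 = 4.\<close>

lemma multiplicity_fib_mult_prime_le:
  assumes p: "prime p" and q: "prime q" and "d > 0" "p dvd fib d"
  shows "multiplicity p (fib (q * d)) \<le> multiplicity p (fib d) + multiplicity p (2 * q)"
proof -
  define x where "x = int (fib d)"
  define A where "A = int (fib (d - 1))"
  have "fib d dvd fib (q * d)"
    by (metis dvd_triv_right fib_gcd gcd_nat.absorb_iff2 gcd_nat.orderI gcd.commute)
  then obtain r where r: "fib (q * d) = fib d * r" by auto
  have x0: "x > 0" using \<open>d > 0\<close> by (simp add: x_def fib_neq_0_nat)
  have q2: "q \<ge> 2" using q prime_ge_2_nat by blast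
  then obtain k where k: "q = Suc k" "k > 0" by (cases q) auto
  have cop: "coprime (fib (d - 1)) (fib d)" using coprime_fib_Suc_nat[of "d - 1"] \<open>d > 0\<close> by simp
  have ip: "prime (int p)" using p by simp
  have pA: "\<not> int p dvd A"
  proof
    assume "int p dvd A"
    then have "p dvd fib (d - 1)" by (simp add: A_def)
    with \<open>p dvd fib d\<close> cop have "p dvd 1" by (metis coprime_common_divisor_nat is_unit_gcd gcd_nat.boundedI coprime_iff_gcd_eq_1)
    then show False using p by simp
  qed
  have px: "int p dvd x" using \<open>p dvd fib d\<close> by (simp add: x_def)
  obtain u where u: "int (fib (q * d)) * A\<^sup>2 =
           int q * x * A ^ (k + 2) + int (q choose 2) * x\<^sup>2 * A ^ (k + 1) + x ^ 3 * u"
    using fib_mult_cong[OF \<open>d > 0\<close>, of k] unfolding x_def A_def k(1) by blast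
  have "x * (int r * A\<^sup>2) = x * (int q * A ^ (k + 2) + int (q choose 2) * x * A ^ (k + 1) + x\<^sup>2 * u)"
    using u unfolding r by (simp add: x_def algebra_simps power2_eq_square power3_eq_cube)
  then have rA: "int r * A\<^sup>2 = int q * A ^ (k + 2) + int (q choose 2) * x * A ^ (k + 1) + x\<^sup>2 * u"
    using x0 by simp
  have r0: "r \<noteq> 0" using r fib_neq_0_nat[of "q * d"] q2 \<open>d > 0\<close> by auto
  have "multiplicity p r \<le> multiplicity p (2 * q)"
  proof (cases "p = q")
    case False
    have "\<not> p dvd r"
    proof
      assume "p dvd r"
      then have "int p dvd int r * A\<^sup>2" by simp
      then have "int p dvd int q * A ^ (k + 2)"
        using px unfolding rA by (simp add: dvd_add_left_iff power2_eq_square)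
      then have "int p dvd int q"
        using ip pA prime_dvd_mult_iff prime_dvd_power by blast
      then have "p dvd q" by simp
      with p q False show False by (simp add: primes_dvd_imp_eq)
    qed
    then show ?thesis by (simp add: not_dvd_imp_multiplicity_0)
  next
    case True
    show ?thesis
    proof (cases "p = 2")
      case False
      have "\<not> p ^ 2 dvd r"
      proof
        assume "p ^ 2 dvd r"
        then have "int p ^ 2 dvd int r * A\<^sup>2" by (metis dvd_mult2 of_nat_dvd_iff of_nat_power)
        moreover have "int p ^ 2 dvd int (q choose 2) * x * A ^ (k + 1)"
        proof -
          have "p dvd (q choose 2)" using False True p
            using prime_ge_2_nat[OF p] by (auto intro!: dvd_choose_prime)
          then have "int p dvd int (q choose 2)" by simp
          then have "int p * int p dvd int (q choose 2) * x" using px by (rule mult_dvd_mono)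
          then show ?thesis by (simp add: power2_eq_square)
        qed
        moreover have "int p ^ 2 dvd x\<^sup>2 * u" using px by (simp add: dvd_power_same dvd_mult2)
        ultimately have "int p ^ 2 dvd int q * A ^ (k + 2)"
          unfolding rA by (metis dvd_add_left_iff)
        then have "int p * int p dvd int p * A ^ (k + 2)" using True by (simp add: power2_eq_square)
        then have "int p dvd A ^ (k + 2)" using p by (simp add: prime_gt_0_nat)
        then show False using pA ip prime_dvd_power by blast
      qed
      then have "multiplicity p r < 2" using r0 by (metis multiplicity_dvd' not_le)
      moreover have "multiplicity p (2 * q) \<ge> 1"
        using True p by (intro multiplicity_geI) (auto simp: prime_gt_0_nat)
      ultimately show ?thesis by simp
    next
      \<comment> \<open>For p = q = 2 the coefficient C(2,2) = 1 is odd and the argument breaks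
        down. Here r is the Lucas number 2 F_(d-1) + F_d, which has period 12 modulo 8 and is never
        0 there.\<close>
      case p2: True
      have q2: "q = 2" using True p2 by simp
      obtain e where e: "d = Suc e" using \<open>d > 0\<close> by (cases d) auto
      have "fib (2 * d) = (2 * fib (d - 1) + fib d) * fib d" by (rule fib_rec_even')
      with r have req: "r = 2 * fib e + fib (Suc e)" using x0 by (simp add: q2 e x_def)
      have per: "(2 * fib n + fib (Suc n)) mod 8 = (2 * fib (n mod 12) + fib (Suc (n mod 12))) mod 8" for n
      proof (induction n rule: less_induct)
        case (less n)
        show ?case
        proof (cases "n < 12")
          case False
          then obtain m where m: "n = 12 + m" using le_Suc_ex not_less by blast
          have "fib 13 = 233" "fib 12 = 144" "fib 11 = 89" by code_simp+
          then have "fib (12 + m) = 144 * fib (Suc m) + 89 * fib m"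
            "fib (Suc (12 + m)) = 233 * fib (Suc m) + 144 * fib m" 
            using fib_add[of 11 m] fib_add[of 12 m] by simp_all
          then have "2 * fib n + fib (Suc n) = 8 * (65 * fib (Suc m) + 40 * fib m) + (2 * fib m + fib (Suc m))"
            unfolding m by simp
          then have "(2 * fib n + fib (Suc n)) mod 8 = (2 * fib m + fib (Suc m)) mod 8" 
            by (simp only: mod_mult_self4)
          also have "\<dots> = (2 * fib (m mod 12) + fib (Suc (m mod 12))) mod 8" 
            using less[of m] m by simp
          finally show ?thesis by (simp add: m)
        qed auto
      qed
      have nz: "(2 * fib j + fib (Suc j)) mod 8 \<noteq> 0" if "j < 12" for j
      proof -
        have "\<forall>j\<in>set [0..<12]. (2 * fib j + fib (Suc j)) mod 8 \<noteq> 0" by code_simp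
        then show ?thesis using that by simp
      qed
      have "r mod 8 \<noteq> 0" using per[of e] nz[of "e mod 12"] unfolding req by simp
      then have "\<not> 2 ^ 3 dvd r" by (simp add: dvd_eq_mod_eq_0)
      then have "multiplicity p r < 3" using r0 p2 by (metis multiplicity_dvd' not_le)
      moreover have "multiplicity p (2 * q) = 2" 
        using p2 q2 by (simp add: multiplicity_prime_power[of "2::nat" 2, simplified])
      ultimately show ?thesis by simp
    qed
  qed
  moreover have "multiplicity p (fib (q * d)) = multiplicity p (fib d) + multiplicity p r"
    unfolding r using p r0 fib_neq_0_nat[OF \<open>d > 0\<close>] by (simp add: prime_elem_multiplicity_mult_distrib)
  ultimately show ?thesis by simp
qed

section \<open>Divisibility of F_n in the absence of a primitive prime\<close>

lemma Lcm_fib_div_pos: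
  assumes "finite P" "n > 0" "\<And>q. q \<in> P \<Longrightarrow> q dvd n"
  shows "Lcm ((\<lambda>q. fib (n div q)) ` P) > 0"
  using assms(1,3)
proof (induction P)
  case (insert q P)
  have "n div q > 0" using insert.prems[of q] \<open>n > 0\<close> by (metis dvd_mult_div_cancel gr0I insertI1 mult_0_right)
  then have "fib (n div q) > 0" by (rule fib_neq_0_nat)
  moreover have "Lcm ((\<lambda>q. fib (n div q)) ` P) > 0" using insert by simp
  ultimately show ?case by (simp add: lcm_pos_nat)
qed simp

text \<open>The prime divides F_g for g = gcd(m, n) < n, and g divides n / q for every prime q
  dividing n / g. Hence primitivity need only be tested at the maximal proper divisors n /
  q.\<close>

lemma prime_factor_dvd_fib_div:
  assumes "p dvd fib n" "p dvd fib m" "0 < m" "m < n"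
  shows "\<exists>q\<in>prime_factors n. p dvd fib (n div q)"
proof -
  define g where "g = gcd m n"
  have "g dvd n" by (simp add: g_def)
  have "g > 0" using assms by (simp add: g_def)
  have "g < n" using assms by (metis g_def gcd_le1_nat le_less_trans not_gr_zero)
  have "p dvd fib g" using assms by (simp add: g_def fib_gcd)
  have "n div g \<noteq> 1" using \<open>g dvd n\<close> \<open>g < n\<close> by auto
  then obtain q where q: "prime q" "q dvd n div g" using prime_factor_nat by blast
  then obtain j where j: "n = g * (q * j)" using \<open>g dvd n\<close> \<open>g > 0\<close>
    by (metis dvd_def dvd_mult_div_cancel)
  have q0: "q > 0" using q prime_gt_0_nat by blast
  have nq: "n div q = g * j" using j q0 by simp
  have "q dvd n" using j by simp
  then have "q \<in> prime_factors n" using q(1) assms by (simp add: prime_factors_dvd)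
  moreover have "p dvd fib (n div q)" 
    using \<open>p dvd fib g\<close> unfolding nq by (metis dvd_trans dvd_triv_left fib_gcd gcd_nat.absorb_iff1)
  ultimately show ?thesis by blast
qed

text \<open>Valuations are compared prime by prime: a non-primitive p divides some F_(n/q), and
  passing from n / q to n raises its valuation by at most that of 2 q. Every such q divides the
  radical, so the single factor 2 rad(n) serves all p.\<close>

lemma fib_dvd_of_no_primitive_prime:
  assumes "n > 0"
    and np: "\<And>p. prime p \<Longrightarrow> p dvd fib n \<Longrightarrow> \<exists>m. 0 < m \<and> m < n \<and> p dvd fib m"
  shows "fib n dvd 2 * \<Prod>(prime_factors n) * Lcm ((\<lambda>q. fib (n div q)) ` prime_factors n)"
    (is "_ dvd 2 * ?R * ?L")
proof (rule multiplicity_le_imp_dvd)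
  show fn0: "fib n \<noteq> 0" using fib_neq_0_nat[OF \<open>n > 0\<close>] by simp
  have L0: "?L \<noteq> 0"
    using Lcm_fib_div_pos[of "prime_factors n" n] \<open>n > 0\<close> in_prime_factors_imp_dvd by blast
  have R0: "?R \<noteq> 0" by (auto simp: prod_zero_iff dest: in_prime_factors_imp_prime)
  fix p :: nat assume p: "prime p"
  show "multiplicity p (fib n) \<le> multiplicity p (2 * ?R * ?L)"
  proof (cases "p dvd fib n")
    case True
    then obtain m where m: "0 < m" "m < n" "p dvd fib m" using np p by blast
    then obtain q where qP: "q \<in> prime_factors n" and pnq: "p dvd fib (n div q)"
      using prime_factor_dvd_fib_div True by blast
    have q: "prime q" and "n = q * (n div q)" using qP by auto
    have "multiplicity p (fib n) \<le> multiplicity p (fib (n div q)) + multiplicity p (2 * q)"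
      using multiplicity_fib_mult_prime_le[OF p q _ pnq] \<open>n = q * (n div q)\<close> \<open>n > 0\<close>
      by (metis nat_0_less_mult_iff)
    also have "multiplicity p (fib (n div q)) \<le> multiplicity p ?L"
      using qP L0 by (intro dvd_imp_multiplicity_le dvd_Lcm) auto
    also have "multiplicity p (2 * q) \<le> multiplicity p (2 * ?R)"
      using qP R0 by (intro dvd_imp_multiplicity_le mult_dvd_mono dvd_prodI) auto
    also have "multiplicity p ?L + multiplicity p (2 * ?R) = multiplicity p (2 * ?R * ?L)"
      using p L0 R0 by (subst prime_elem_multiplicity_mult_distrib[of p "2 * ?R"]) auto
    finally show ?thesis by simp
  qed (simp add: not_dvd_imp_multiplicity_0)
qed

section \<open>Golden-ratio bounds for F_n and for its quotient by the lcm\<close>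

definition golden :: real where "golden = (1 + sqrt 5) / 2"

lemma golden_bounds: "golden > 1618/1000" "golden < 1619/1000"
proof -
  have "sqrt 5 > 2236/1000" by (rule real_less_rsqrt) (simp add: power2_eq_square)
  moreover have "sqrt 5 < 2238/1000" by (rule real_less_lsqrt) (simp_all add: power2_eq_square)
  ultimately show "golden > 1618/1000" "golden < 1619/1000" by (simp_all add: golden_def)
qed

lemma golden_gt_1: "golden > 1" using golden_bounds by simp

lemma golden_powr_rec: "golden powr (x + 2) = golden powr (x + 1) + golden powr x"
proof -
  have sq: "golden * golden = golden + 1" by (simp add: golden_def field_simps)
  have "golden powr (x + 2) = golden powr x * (golden * golden)"
    using golden_gt_1 by (simp add: powr_add powr_numeral power2_eq_square)
  also have "\<dots> = golden powr (x + 1) + golden powr x"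
    using golden_gt_1 unfolding sq by (simp add: powr_add algebra_simps)
  finally show ?thesis .
qed

text \<open>Both bounds satisfy the Fibonacci recursion. Exponents are real since
  \<open>n - 2\<close> is negative at \<open>n = 1\<close>; F_2 is checked separately because F_0 =
  0 violates the lower bound.\<close>

lemma fib_golden_bounds:
  "n > 0 \<Longrightarrow> golden powr (real n - 2) \<le> real (fib n) \<and> real (fib n) \<le> golden powr (real n - 1)"
proof (induction n rule: fib.induct)
  case 2
  then show ?case using golden_gt_1 powr_mono[of "-1" 0 golden] by simp
next
  case (3 n)
  show ?case
  proof (cases "n = 0")
    case True
    then show ?thesis using golden_gt_1 by simp
  next
    case False
    with 3 have "golden powr (real n - 2) \<le> real (fib n)" "real (fib n) \<le> golden powr (real n - 1)"
      "golden powr (real n - 2 + 1) \<le> real (fib (Suc n))" "real (fib (Suc n)) \<le> golden powr (real n - 1 + 1)"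
      by (simp_all add: algebra_simps)
    then show ?thesis using golden_powr_rec[of "real n - 2"] golden_powr_rec[of "real n - 1"] by (simp add: algebra_simps)
  qed
qed simp

lemma gcd_Lcm_finite:
  fixes a :: nat
  assumes "finite A"
  shows "gcd a (Lcm (f ` A)) = Lcm ((\<lambda>x. gcd a (f x)) ` A)"
  using assms by (induction A) (simp_all add: gcd_lcm_distrib)

text \<open>
  By distributivity of gcd over lcm, adding a prime \<open>p\<close> to \<open>P\<close> replaces \<open>Q n\<close> by
  \<open>Q n / Q (n / p)\<close>, so the errors of the two bounds on \<open>F\<^sub>n\<close> double at each step.
\<close>
lemma fib_quotient_bounds:
  assumes "finite P" "P \<noteq> {}" "\<And>p. p \<in> P \<Longrightarrow> prime p" "n > 0" "\<Prod>P dvd n"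
  defines "c \<equiv> \<lambda>n::nat. real n * (\<Prod>p\<in>P. 1 - 1 / real p)"
  defines "Q \<equiv> \<lambda>n. real (fib n) / real (Lcm ((\<lambda>q. fib (n div q)) ` P))"
  shows "golden powr (c n - 2 ^ (card P - 1)) \<le> Q n \<and> Q n \<le> golden powr (c n + 2 ^ (card P - 1))"
  using assms(1-5) unfolding c_def Q_def
proof (induction P arbitrary: n rule: finite_ne_induct)
  case (singleton p)
  have p: "p > 0" using singleton by (auto simp: prime_gt_0_nat)
  define m where "m = n div p"
  have n: "n = p * m" using singleton by (simp add: m_def)
  have m: "m > 0" using singleton n by simp
  have c: "real n * (1 - 1 / real p) = real n - real m" using p by (simp add: n field_simps)
  note fn = fib_golden_bounds[OF \<open>n > 0\<close>] and fm = fib_golden_bounds[OF m]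
  have fm0: "real (fib m) > 0" using m fib_neq_0_nat by simp
  have "golden powr (real n - real m - 1) = golden powr (real n - 2) / golden powr (real m - 1)"
    using golden_gt_1 by (simp flip: powr_diff)
  also have "\<dots> \<le> real (fib n) / real (fib m)"
    using fn fm fm0 by (intro frac_le) auto
  finally have 1: "golden powr (real n - real m - 1) \<le> real (fib n) / real (fib m)" .
  have "real (fib n) / real (fib m) \<le> golden powr (real n - 1) / golden powr (real m - 2)"
    using fn fm fm0 golden_gt_1 by (intro frac_le) auto
  also have "\<dots> = golden powr (real n - real m + 1)"
    using golden_gt_1 by (simp add: algebra_simps flip: powr_diff)
  finally show ?case using 1 c by (simp add: m_def)
next
  case (insert p P)
  have p: "prime p" "p > 0" using insert by (auto simp: prime_gt_0_nat)
  have pP: "p * \<Prod>P dvd n" using insert by simp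
  define m where "m = n div p"
  have n: "n = p * m" using pP by (metis m_def dvd_mult_div_cancel dvd_mult_left)
  have m: "m > 0" using insert n by simp
  have dm: "\<Prod>P dvd m" using pP p by (simp add: n)
  define L1 where "L1 = Lcm ((\<lambda>q. fib (n div q)) ` P)"
  define L2 where "L2 = Lcm ((\<lambda>q. fib (m div q)) ` P)"
  have dq: "q dvd m" if "q \<in> P" for q
    using that dm insert.hyps(1) by (metis dvd_prodI dvd_trans prod.cong)
  \<comment> \<open>For distinct primes p and q, gcd(n / p, n / q) = n / (p q), so the gcd of F_m
    with the old lcm is the lcm belonging to m.\<close>
  have "gcd (fib m) (fib (n div q)) = fib (m div q)" if "q \<in> P" for q
  proof -
    have q: "prime q" "q \<noteq> p" using that insert by auto
    have "q dvd m" using that by (rule dq)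
    then obtain j where j: "m = q * j" by auto
    have q0: "q > 0" using q prime_gt_0_nat by blast
    have "coprime q p" using p q primes_coprime by blast
    have "n div q = p * j" using n j q0 by (simp add: mult.left_commute)
    moreover have "gcd (j * q) (j * p) = j"
      using \<open>coprime q p\<close> by (metis coprime_iff_gcd_eq_1 gcd_mult_distrib_nat mult.right_neutral)
    ultimately have "gcd m (n div q) = j" 
      by (metis j mult.commute)
    moreover have "m div q = j" using j q0 by simp
    ultimately show ?thesis by (simp flip: fib_gcd)
  qed
  then have g: "gcd (fib m) L1 = L2" unfolding L1_def L2_def gcd_Lcm_finite[OF insert.hyps(1)]
    by (metis (no_types, lifting) image_cong)
  have Leq: "Lcm ((\<lambda>q. fib (n div q)) ` insert p P) = lcm (fib m) L1"
    by (simp add: L1_def m_def)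
  have prod: "lcm (fib m) L1 * L2 = fib m * L1"
    using g by (metis prod_gcd_lcm_nat mult.commute)
  have fm0: "fib m > 0" using m fib_neq_0_nat by simp
  have "n > 0" using insert by simp
  have L10: "L1 > 0" unfolding L1_def
    by (rule Lcm_fib_div_pos) (use \<open>n > 0\<close> insert.hyps(1) dq n in auto)
  have L20: "L2 > 0" using g fm0 by auto
  have Q: "real (fib n) / real (lcm (fib m) L1) = (real (fib n) / real L1) / (real (fib m) / real L2)"
  proof -
    have "real (lcm (fib m) L1) * real L2 = real (fib m) * real L1"
      using prod by (metis of_nat_mult)
    moreover have "lcm (fib m) L1 > 0" using fm0 L10 by (simp add: lcm_pos_nat)
    ultimately show ?thesis using fm0 L10 L20 by (simp add: field_simps)
  qed
  have IHn: "golden powr (real n * (\<Prod>p\<in>P. 1 - 1 / real p) - 2 ^ (card P - 1)) \<le> real (fib n) / real L1 \<and>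
     real (fib n) / real L1 \<le> golden powr (real n * (\<Prod>p\<in>P. 1 - 1 / real p) + 2 ^ (card P - 1))"
    unfolding L1_def using insert.prems dm by (intro insert.IH) (auto simp: n)
  have IHm: "golden powr (real m * (\<Prod>p\<in>P. 1 - 1 / real p) - 2 ^ (card P - 1)) \<le> real (fib m) / real L2 \<and>
     real (fib m) / real L2 \<le> golden powr (real m * (\<Prod>p\<in>P. 1 - 1 / real p) + 2 ^ (card P - 1))"
    unfolding L2_def using insert.prems dm m by (intro insert.IH) auto
  define c where "c = (\<Prod>p\<in>P. 1 - 1 / real p)"
  have e: "(2::real) ^ (card (insert p P) - 1) = 2 ^ (card P - 1) + 2 ^ (card P - 1)"
  proof -
    have "card P > 0" using insert.hyps by (simp add: card_gt_0_iff)
    then obtain k where "card P = Suc k" by (cases "card P") auto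
    then show ?thesis using insert.hyps by simp
  qed
  have c': "real n * (\<Prod>p\<in>insert p P. 1 - 1 / real p) = real n * c - real m * c"
    using insert.hyps p by (simp add: c_def[symmetric] n field_simps)
  have pos: "real (fib m) / real L2 > 0" using fm0 L20 by simp
  have "golden powr (real n * c - real m * c - (2 ^ (card P - 1) + 2 ^ (card P - 1)))
     = golden powr (real n * c - 2 ^ (card P - 1)) / golden powr (real m * c + 2 ^ (card P - 1))"
    using golden_gt_1 by (simp add: algebra_simps flip: powr_diff)
  also have "\<dots> \<le> (real (fib n) / real L1) / (real (fib m) / real L2)"
    using IHn IHm pos unfolding c_def[symmetric] by (intro frac_le) auto
  finally have lo: "golden powr (real n * c - real m * c - (2 ^ (card P - 1) + 2 ^ (card P - 1)))
    \<le> (real (fib n) / real L1) / (real (fib m) / real L2)" .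
  have "(real (fib n) / real L1) / (real (fib m) / real L2) \<le> 
     golden powr (real n * c + 2 ^ (card P - 1)) / golden powr (real m * c - 2 ^ (card P - 1))"
    using IHn IHm pos golden_gt_1 unfolding c_def[symmetric] by (intro frac_le) auto
  also have "\<dots> = golden powr (real n * c - real m * c + (2 ^ (card P - 1) + 2 ^ (card P - 1)))"
    using golden_gt_1 by (simp add: algebra_simps flip: powr_diff)
  finally show ?case unfolding Leq Q c' e using lo by blast
qed

section \<open>The size criterion and its stability under multiplication\<close>

text \<open>
  The size condition that forces a primitive prime divisor. Above \<open>12\<close> it fails only for
  \<open>n = 14, 15, 18, 20, 30, 42\<close>, because it survives multiplication
  of \<open>n\<close> by any prime other than a new factor \<open>2\<close>.
\<close>
definition fib_large :: "nat \<Rightarrow> bool" where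
  "fib_large n \<longleftrightarrow> real (2 * \<Prod>(prime_factors n)) <
     golden powr (real (totient n) - 2 ^ (card (prime_factors n) - 1))"

definition primitive_prime :: "nat \<Rightarrow> nat \<Rightarrow> bool" where
  "primitive_prime p n \<longleftrightarrow> prime p \<and> p dvd fib n \<and> (\<forall>m. 0 < m \<and> m < n \<longrightarrow> \<not> p dvd fib m)"

text \<open>Euler's product turns the exponent in \<open>fib_quotient_bounds\<close> into phi(n). So
  the lower bound for the quotient exceeds the upper bound 2 rad(n) that the absence of a primitive
  prime would impose.\<close>

lemma primitive_prime_if_large:
  assumes "n > 1" "fib_large n"
  shows "\<exists>p. primitive_prime p n"
proof (rule ccontr)
  assume contra: "\<nexists>p. primitive_prime p n"
  define P where "P = prime_factors n"
  define L where "L = Lcm ((\<lambda>q. fib (n div q)) ` P)"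
  have "fib n dvd 2 * \<Prod>P * L" unfolding P_def L_def
    by (rule fib_dvd_of_no_primitive_prime) (use contra assms in \<open>auto simp: primitive_prime_def\<close>)
  moreover have "L > 0" unfolding L_def P_def
    by (rule Lcm_fib_div_pos) (use assms in auto)
  moreover have "\<Prod>P > 0" unfolding P_def
    by (rule prod_pos) (meson in_prime_factors_imp_prime prime_gt_0_nat)
  ultimately have "fib n \<le> 2 * \<Prod>P * L" by (intro dvd_imp_le) auto
  then have "real (fib n) \<le> real (2 * \<Prod>P) * real L" by (metis of_nat_le_iff of_nat_mult)
  then have up: "real (fib n) / real L \<le> real (2 * \<Prod>P)"
    using \<open>L > 0\<close> by (simp add: field_simps)
  have "\<Prod>P dvd n"
  proof -
    have "\<Prod>P dvd (\<Prod>p\<in>P. p ^ multiplicity p n)" unfolding P_def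
      by (rule prod_dvd_prod) (auto simp: prime_factors_multiplicity)
    then show ?thesis unfolding P_def using assms by (simp add: prod_prime_factors)
  qed
  moreover have "P \<noteq> {}" using prime_factor_nat[of n] assms by (auto simp: P_def prime_factors_dvd)
  ultimately have "golden powr (real n * (\<Prod>p\<in>P. 1 - 1 / real p) - 2 ^ (card P - 1)) \<le> real (fib n) / real L"
    unfolding L_def using fib_quotient_bounds[of P n] assms by (auto simp: P_def)
  with up assms(2) show False by (simp add: fib_large_def totient_formula2 P_def)
qed

text \<open>If p divides n, the radical and the number of prime factors are unchanged while phi
  grows. Otherwise p is at least 3: phi gains the factor p - 1 and the error term only the factor 2,
  so the exponent e becomes at least (p - 1) e, and p (2 R) <= (2 R)^(p - 1) does the rest.\<close>

lemma fib_large_mult_prime: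
  assumes "fib_large n" "n > 1" "prime p" "p dvd n \<or> p \<noteq> 2"
  shows "fib_large (n * p)"
proof -
  define R where "R = \<Prod>(prime_factors n)"
  define e where "e = real (totient n) - 2 ^ (card (prime_factors n) - 1)"
  have h: "real (2 * R) < golden powr e" using assms by (simp add: fib_large_def R_def e_def)
  have "R > 0" unfolding R_def by (rule prod_pos) (meson in_prime_factors_imp_prime prime_gt_0_nat)
  have "golden powr e > golden powr 0" using h \<open>R > 0\<close> golden_gt_1 by simp
  then have "e > 0" using golden_gt_1 by (simp only: powr_less_cancel_iff)
  have p2: "p \<ge> 2" using assms prime_ge_2_nat by blast
  have pf: "prime_factors (n * p) = insert p (prime_factors n)"
    using assms by (simp add: prime_factors_product prime_prime_factors)
  show ?thesis
  proof (cases "p dvd n")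
    case True
    then have pf': "prime_factors (n * p) = prime_factors n"
      unfolding pf using assms by (auto simp: prime_factors_dvd)
    have "real (totient (n * p)) = p * real (totient n)"
      unfolding totient_formula2 pf' by simp
    moreover have "p * real (totient n) \<ge> 1 * real (totient n)"
      using p2 by (intro mult_right_mono) auto
    ultimately have "e \<le> real (totient (n * p)) - 2 ^ (card (prime_factors n) - 1)"
      unfolding e_def by simp
    then have "golden powr e \<le> golden powr (real (totient (n * p)) - 2 ^ (card (prime_factors n) - 1))"
      using golden_gt_1 by (intro powr_mono) auto
    then show ?thesis using h unfolding fib_large_def pf' R_def by simp
  next
    case False
    then have "p \<ge> 3" using assms p2 by simp
    have cop: "coprime n p" using False assms by (metis coprime_commute prime_imp_coprime)
    have tot: "real (totient (n * p)) = (real p - 1) * real (totient n)"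
      using cop assms p2 by (simp add: totient_mult_coprime totient_prime of_nat_diff)
    have pn: "p \<notin> prime_factors n" using False by auto
    have R: "\<Prod>(prime_factors (n * p)) = p * R" unfolding pf R_def using pn by simp
    have "prime_factors n \<noteq> {}" using prime_factor_nat[of n] assms by (auto simp: prime_factors_dvd)
    then obtain k where k: "card (prime_factors n) = Suc k"
      by (metis card_gt_0_iff finite_set_mset gr0_implies_Suc)
    have c: "card (prime_factors (n * p)) = Suc (Suc k)" unfolding pf using pn k by simp
    have "(2::real) * 2 ^ k \<le> (real p - 1) * 2 ^ k"
      using \<open>p \<ge> 3\<close> by (intro mult_right_mono) auto
    then have le: "(real p - 1) * e \<le> real (totient (n * p)) - 2 ^ (card (prime_factors (n * p)) - 1)"
      unfolding e_def k c tot by (simp add: algebra_simps)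
    obtain j where j: "p = j + 3" using \<open>p \<ge> 3\<close> by (metis add.commute le_Suc_ex)
    obtain q where q: "q \<in> prime_factors n" using \<open>prime_factors n \<noteq> {}\<close> by blast
    then have "q \<ge> 2" by (meson in_prime_factors_imp_prime prime_ge_2_nat)
    moreover have "q dvd R" unfolding R_def using q by (intro dvd_prodI) auto
    ultimately have "R \<ge> 2" using \<open>R > 0\<close> by (meson dvd_imp_le le_trans)
    \<comment> \<open>This is p <= 4^(p - 2), combined with 2 R >= 4.\<close>
    have "j + 3 \<le> 4 ^ (j + 1)" by (induction j) auto
    also have "(4::nat) ^ (j + 1) \<le> (2 * R) ^ (j + 1)" using \<open>R \<ge> 2\<close> by (intro power_mono) auto
    finally have "p * (2 * R) \<le> (2 * R) ^ (j + 1) * (2 * R)" unfolding j by (intro mult_right_mono) auto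
    also have "\<dots> = (2 * R) ^ (p - 1)" by (simp add: j)
    finally have "real p * real (2 * R) \<le> real (2 * R) ^ (p - 1)"
      by (metis of_nat_le_iff of_nat_mult of_nat_power)
    also have "\<dots> < (golden powr e) ^ (p - 1)"
      using h \<open>R > 0\<close> p2 by (intro power_strict_mono) auto
    also have "\<dots> = golden powr ((real p - 1) * e)"
      using golden_gt_1 p2 by (simp add: powr_powr_swap powr_realpow[symmetric] powr_powr mult.commute of_nat_diff)
    also have "\<dots> \<le> golden powr (real (totient (n * p)) - 2 ^ (card (prime_factors (n * p)) - 1))"
      using le golden_gt_1 by (intro powr_mono) auto
    finally show ?thesis unfolding fib_large_def R by (simp add: algebra_simps)
  qed
qed

text \<open>The parity condition excludes exactly a new factor 2, and it is inherited when the
  primes of m are moved into n one at a time.\<close>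

lemma fib_large_mult:
  assumes "fib_large n" "n > 1" "m > 0" "even n \<or> odd m"
  shows "fib_large (n * m)"
  using assms
proof (induction m arbitrary: n rule: less_induct)
  case (less m)
  show ?case
  proof (cases "m = 1")
    case False
    then obtain p where p: "prime p" "p dvd m" using prime_factor_nat by blast
    then obtain k where k: "m = p * k" by auto
    have p2: "p \<ge> 2" using p prime_ge_2_nat by blast
    have "p dvd n \<or> p \<noteq> 2" using less.prems(4) p by auto
    then have "fib_large (n * p)" using fib_large_mult_prime less.prems p by blast
    moreover have "k > 0" using k less.prems by auto
    moreover have "k < m" using k p2 \<open>k > 0\<close> by simp
    moreover have "n * p > 1" using less.prems p2 by (metis less_1_mult less_le_trans one_less_numeral_iff semiring_norm(76))
    moreover have "even (n * p) \<or> odd k" using less.prems k by auto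
    ultimately have "fib_large (n * p * k)" using less.IH by blast
    then show ?thesis by (simp add: k mult.assoc)
  qed (use less in simp)
qed

lemma fib_large_multI:
  assumes "fib_large n" "n dvd m" "n > 1" "m > 0" "even n \<or> odd m"
  shows "fib_large m"
proof -
  obtain k where k: "m = n * k" using assms by auto
  then show ?thesis using fib_large_mult[of n k] assms by auto
qed

text \<open>\<open>k\<close> is the exponent in \<open>fib_large\<close>, so the real power becomes
  a natural power of the rational lower bound 1.618 and the test is plain arithmetic.\<close>

lemma fib_large_numeralI:
  assumes "prime_factors n = P" "totient n = 2 ^ (card P - 1) + k"
    "real (2 * \<Prod>P) < (1618/1000) ^ k"
  shows "fib_large n"
proof -
  have "real (2 * \<Prod>P) < (1618/1000) ^ k" by fact
  also have "\<dots> \<le> golden ^ k" using golden_bounds by (intro power_mono) auto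
  also have "\<dots> = golden powr (real (totient n) - 2 ^ (card P - 1))"
    using golden_gt_1 by (simp add: assms(2) powr_realpow)
  finally show ?thesis by (simp add: fib_large_def assms(1))
qed

text \<open>One inequality, 4 p < 1.618^(p - 3), settles both claims, the exponents being p - 2 for
  p and p - 3 for 2 p. It fails at p = 7 and holds from p = 11 on, where 44 < 1.618^8.\<close>

lemma fib_large_prime:
  assumes "prime p" "p \<ge> 11"
  shows "fib_large p" "fib_large (2 * p)"
proof -
  have pw: "real (4 * (j + 11)) < (1618/1000) ^ (j + 8)" for j :: nat
  proof (induction j)
    case (Suc j)
    have e: "(1618/1000) ^ (Suc j + 8) = (1618/1000) ^ (j + 8) * (1618/1000 :: real)"
      by (metis add_Suc power_Suc2)
    have "real (4 * (Suc j + 11)) \<le> real (4 * (j + 11)) * (1618/1000)" by simp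
    also have "\<dots> < (1618/1000) ^ (j + 8) * (1618/1000)"
      using Suc by (intro mult_strict_right_mono) auto
    finally show ?case unfolding e .
  qed (simp add: power_divide)
  obtain j where j: "p = j + 11" using assms by (metis add.commute le_Suc_ex)
  have "real (2 * \<Prod>{p}) \<le> real (4 * (j + 11))" by (simp add: j)
  also have "\<dots> < (1618/1000) ^ (j + 8)" by (rule pw)
  also have "\<dots> \<le> (1618/1000) ^ (j + 9)" by (rule power_increasing) auto
  finally have 1: "real (2 * \<Prod>{p}) < (1618/1000) ^ (j + 9)" .
  show "fib_large p"
    by (rule fib_large_numeralI[OF _ _ 1]) (use assms in \<open>simp_all add: prime_prime_factors totient_prime j\<close>)
  have 2: "real (2 * \<Prod>{2,p}) < (1618/1000) ^ (j + 8)"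
    using pw[of j] j by simp
  have cop: "coprime 2 p" using assms by (simp add: prime_odd_nat)
  have pf: "prime_factors (2 * p) = {2, p}"
    using assms by (subst prime_factors_product) (auto simp: prime_prime_factors)
  have tot: "totient (2 * p) = 2 ^ (card {2, p} - 1) + (j + 8)"
    using assms cop by (subst totient_mult_coprime) (auto simp: totient_prime j)
  show "fib_large (2 * p)" by (rule fib_large_numeralI[OF pf tot 2])
qed

lemma primitive_primeI:
  assumes "prime p" "p dvd fib n" "\<And>q. q \<in> prime_factors n \<Longrightarrow> \<not> p dvd fib (n div q)"
  shows "\<exists>p. primitive_prime p n"
  using assms prime_factor_dvd_fib_div unfolding primitive_prime_def by blast

lemma prime_factors_numerals:
  "prime_factors (4::nat) = {2}"
  "prime_factors (6::nat) = {2, 3}"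
  "prime_factors (8::nat) = {2}"
  "prime_factors (9::nat) = {3}"
  "prime_factors (10::nat) = {2, 5}"
  "prime_factors (12::nat) = {2, 3}"
  "prime_factors (14::nat) = {2, 7}"
  "prime_factors (15::nat) = {3, 5}"
  "prime_factors (18::nat) = {2, 3}"
  "prime_factors (20::nat) = {2, 5}"
  "prime_factors (21::nat) = {3, 7}"
  "prime_factors (25::nat) = {5}"
  "prime_factors (27::nat) = {3}"
  "prime_factors (28::nat) = {2, 7}"
  "prime_factors (30::nat) = {2, 3, 5}"
  "prime_factors (35::nat) = {5, 7}"
  "prime_factors (36::nat) = {2, 3}"
  "prime_factors (42::nat) = {2, 3, 7}"
  "prime_factors (45::nat) = {3, 5}"
  "prime_factors (49::nat) = {7}"
  "prime_factors (50::nat) = {2, 5}"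
  "prime_factors (54::nat) = {2, 3}"
  "prime_factors (60::nat) = {2, 3, 5}"
  "prime_factors (63::nat) = {3, 7}"
  "prime_factors (70::nat) = {2, 5, 7}"
  "prime_factors (90::nat) = {2, 3, 5}"
  "prime_factors (98::nat) = {2, 7}"
  "prime_factors (126::nat) = {2, 3, 7}"
proof -
  have *: "prime_factors (p * m) = insert p (prime_factors m)" if "prime p" "m > 0" for p m :: nat
    using that by (simp add: prime_factors_product prime_prime_factors)
  have n4: "prime_factors (4::nat) = {2}"
    using *[of 2 2] by (simp add: prime_prime_factors[of 2])
  have n6: "prime_factors (6::nat) = {2, 3}"
    using *[of 2 3] by (simp add: prime_prime_factors[of 3])
  have n8: "prime_factors (8::nat) = {2}"
    using *[of 2 4] by (simp add: n4)
  have n9: "prime_factors (9::nat) = {3}"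
    using *[of 3 3] by (simp add: prime_prime_factors[of 3])
  have n10: "prime_factors (10::nat) = {2, 5}"
    using *[of 2 5] by (simp add: prime_prime_factors[of 5])
  have n12: "prime_factors (12::nat) = {2, 3}"
    using *[of 2 6] by (simp add: n6)
  have n14: "prime_factors (14::nat) = {2, 7}"
    using *[of 2 7] by (simp add: prime_prime_factors[of 7])
  have n15: "prime_factors (15::nat) = {3, 5}"
    using *[of 3 5] by (simp add: prime_prime_factors[of 5])
  have n18: "prime_factors (18::nat) = {2, 3}"
    using *[of 2 9] by (simp add: n9)
  have n20: "prime_factors (20::nat) = {2, 5}"
    using *[of 2 10] by (simp add: n10)
  have n21: "prime_factors (21::nat) = {3, 7}"
    using *[of 3 7] by (simp add: prime_prime_factors[of 7])
  have n25: "prime_factors (25::nat) = {5}"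
    using *[of 5 5] by (simp add: prime_prime_factors[of 5])
  have n27: "prime_factors (27::nat) = {3}"
    using *[of 3 9] by (simp add: n9)
  have n28: "prime_factors (28::nat) = {2, 7}"
    using *[of 2 14] by (simp add: n14)
  have n30: "prime_factors (30::nat) = {2, 3, 5}"
    using *[of 2 15] by (simp add: n15)
  have n35: "prime_factors (35::nat) = {5, 7}"
    using *[of 5 7] by (simp add: prime_prime_factors[of 7])
  have n36: "prime_factors (36::nat) = {2, 3}"
    using *[of 2 18] by (simp add: n18)
  have n42: "prime_factors (42::nat) = {2, 3, 7}"
    using *[of 2 21] by (simp add: n21)
  have n45: "prime_factors (45::nat) = {3, 5}"
    using *[of 3 15] by (simp add: n15)
  have n49: "prime_factors (49::nat) = {7}"
    using *[of 7 7] by (simp add: prime_prime_factors[of 7])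
  have n50: "prime_factors (50::nat) = {2, 5}"
    using *[of 2 25] by (simp add: n25)
  have n54: "prime_factors (54::nat) = {2, 3}"
    using *[of 2 27] by (simp add: n27)
  have n60: "prime_factors (60::nat) = {2, 3, 5}"
    using *[of 2 30] by (simp add: n30)
  have n63: "prime_factors (63::nat) = {3, 7}"
    using *[of 3 21] by (simp add: n21)
  have n70: "prime_factors (70::nat) = {2, 5, 7}"
    using *[of 2 35] by (simp add: n35)
  have n90: "prime_factors (90::nat) = {2, 3, 5}"
    using *[of 2 45] by (simp add: n45)
  have n98: "prime_factors (98::nat) = {2, 7}"
    using *[of 2 49] by (simp add: n49)
  have n126: "prime_factors (126::nat) = {2, 3, 7}"
    using *[of 2 63] by (simp add: n63)
  show "prime_factors (4::nat) = {2}"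
    "prime_factors (6::nat) = {2, 3}"
    "prime_factors (8::nat) = {2}"
    "prime_factors (9::nat) = {3}"
    "prime_factors (10::nat) = {2, 5}"
    "prime_factors (12::nat) = {2, 3}"
    "prime_factors (14::nat) = {2, 7}"
    "prime_factors (15::nat) = {3, 5}"
    "prime_factors (18::nat) = {2, 3}"
    "prime_factors (20::nat) = {2, 5}"
    "prime_factors (21::nat) = {3, 7}"
    "prime_factors (25::nat) = {5}"
    "prime_factors (27::nat) = {3}"
    "prime_factors (28::nat) = {2, 7}"
    "prime_factors (30::nat) = {2, 3, 5}"
    "prime_factors (35::nat) = {5, 7}"
    "prime_factors (36::nat) = {2, 3}"
    "prime_factors (42::nat) = {2, 3, 7}"
    "prime_factors (45::nat) = {3, 5}"
    "prime_factors (49::nat) = {7}"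
    "prime_factors (50::nat) = {2, 5}"
    "prime_factors (54::nat) = {2, 3}"
    "prime_factors (60::nat) = {2, 3, 5}"
    "prime_factors (63::nat) = {3, 7}"
    "prime_factors (70::nat) = {2, 5, 7}"
    "prime_factors (90::nat) = {2, 3, 5}"
    "prime_factors (98::nat) = {2, 7}"
    "prime_factors (126::nat) = {2, 3, 7}"
    by (rule n4, rule n6, rule n8, rule n9, rule n10, rule n12, rule n14, rule n15, rule n18, rule n20, rule n21, rule n25, rule n27, rule n28, rule n30, rule n35, rule n36, rule n42, rule n45, rule n49, rule n50, rule n54, rule n60, rule n63, rule n70, rule n90, rule n98, rule n126)
qed

text \<open>Base cases from which, together with \<open>fib_large_prime\<close>, all n > 12 outside
  the six exceptions are reached by multiplication. The summands 3, 19, 18, ... are the exponents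
  phi(n) - 2^(omega(n) - 1).\<close>

lemma fib_large_numerals:
  assumes "n \<in> {8, 25, 50, 27, 54, 49, 98, 21, 28, 36, 35, 45, 60, 70, 90, 126}"
  shows "fib_large n"
proof -
  have t8: "totient 8 = 2 ^ (card {2::nat} - 1) + 3" by code_simp
  have t25: "totient 25 = 2 ^ (card {5::nat} - 1) + 19" by code_simp
  have t50: "totient 50 = 2 ^ (card {2::nat, 5} - 1) + 18" by code_simp
  have t27: "totient 27 = 2 ^ (card {3::nat} - 1) + 17" by code_simp
  have t54: "totient 54 = 2 ^ (card {2::nat, 3} - 1) + 16" by code_simp
  have t49: "totient 49 = 2 ^ (card {7::nat} - 1) + 41" by code_simp
  have t98: "totient 98 = 2 ^ (card {2::nat, 7} - 1) + 40" by code_simp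
  have t21: "totient 21 = 2 ^ (card {3::nat, 7} - 1) + 10" by code_simp
  have t28: "totient 28 = 2 ^ (card {2::nat, 7} - 1) + 10" by code_simp
  have t36: "totient 36 = 2 ^ (card {2::nat, 3} - 1) + 10" by code_simp
  have t35: "totient 35 = 2 ^ (card {5::nat, 7} - 1) + 22" by code_simp
  have t45: "totient 45 = 2 ^ (card {3::nat, 5} - 1) + 22" by code_simp
  have t60: "totient 60 = 2 ^ (card {2::nat, 3, 5} - 1) + 12" by code_simp
  have t70: "totient 70 = 2 ^ (card {2::nat, 5, 7} - 1) + 20" by code_simp
  have t90: "totient 90 = 2 ^ (card {2::nat, 3, 5} - 1) + 20" by code_simp
  have t126: "totient 126 = 2 ^ (card {2::nat, 3, 7} - 1) + 32" by code_simp
  have "fib_large 8"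
    by (rule fib_large_numeralI[OF prime_factors_numerals(3) t8]) (simp add: power_divide)
  moreover have "fib_large 25"
    by (rule fib_large_numeralI[OF prime_factors_numerals(12) t25]) (simp add: power_divide)
  moreover have "fib_large 50"
    by (rule fib_large_numeralI[OF prime_factors_numerals(21) t50]) (simp add: power_divide)
  moreover have "fib_large 27"
    by (rule fib_large_numeralI[OF prime_factors_numerals(13) t27]) (simp add: power_divide)
  moreover have "fib_large 54"
    by (rule fib_large_numeralI[OF prime_factors_numerals(22) t54]) (simp add: power_divide)
  moreover have "fib_large 49"
    by (rule fib_large_numeralI[OF prime_factors_numerals(20) t49]) (simp add: power_divide)
  moreover have "fib_large 98"
    by (rule fib_large_numeralI[OF prime_factors_numerals(27) t98]) (simp add: power_divide)
  moreover have "fib_large 21"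
    by (rule fib_large_numeralI[OF prime_factors_numerals(11) t21]) (simp add: power_divide)
  moreover have "fib_large 28"
    by (rule fib_large_numeralI[OF prime_factors_numerals(14) t28]) (simp add: power_divide)
  moreover have "fib_large 36"
    by (rule fib_large_numeralI[OF prime_factors_numerals(17) t36]) (simp add: power_divide)
  moreover have "fib_large 35"
    by (rule fib_large_numeralI[OF prime_factors_numerals(16) t35]) (simp add: power_divide)
  moreover have "fib_large 45"
    by (rule fib_large_numeralI[OF prime_factors_numerals(19) t45]) (simp add: power_divide)
  moreover have "fib_large 60"
    by (rule fib_large_numeralI[OF prime_factors_numerals(23) t60]) (simp add: power_divide)
  moreover have "fib_large 70"
    by (rule fib_large_numeralI[OF prime_factors_numerals(25) t70]) (simp add: power_divide)
  moreover have "fib_large 90"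
    by (rule fib_large_numeralI[OF prime_factors_numerals(26) t90]) (simp add: power_divide)
  moreover have "fib_large 126"
    by (rule fib_large_numeralI[OF prime_factors_numerals(28) t126]) (simp add: power_divide)
  ultimately show ?thesis using assms by auto
qed

lemma primitive_prime_small:
  assumes "n \<in> {3,4,5,7,8,9,10,11,14,15,18,20,30,42}"
  shows "\<exists>p. primitive_prime p n"
proof -
  have f: "fib 2 = 1" "fib 3 = 2" "fib 4 = 3" "fib 5 = 5" "fib 6 = 8" "fib 7 = 13" "fib 8 = 21" "fib 9 = 34"
    "fib 10 = 55" "fib 11 = 89" by code_simp+
  have g: "fib 14 = 377" "fib 15 = 610" "fib 18 = 2584" "fib 20 = 6765" "fib 21 = 10946" 
    using fib_rec_even'[of 7] fib_add[of 7 7] fib_rec_even'[of 9] fib_rec_even'[of 10] fib_add[of 10 10] by (simp_all add: f)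
  have h: "fib 30 = 832040" "fib 42 = 267914296" 
    using fib_rec_even'[of 15] fib_rec_even'[of 21] by (simp_all add: g)
  note [simp] = f g h prime_factors_numerals prime_prime_factors[of 3] prime_prime_factors[of 5]
    prime_prime_factors[of 7] prime_prime_factors[of 11]
  have "\<exists>p. primitive_prime p 3" by (rule primitive_primeI[of 2]) auto
  moreover have "\<exists>p. primitive_prime p 4" by (rule primitive_primeI[of 3]) auto
  moreover have "\<exists>p. primitive_prime p 5" by (rule primitive_primeI[of 5]) auto
  moreover have "\<exists>p. primitive_prime p 7" by (rule primitive_primeI[of 13]) auto
  moreover have "\<exists>p. primitive_prime p 8" by (rule primitive_primeI[of 7]) auto
  moreover have "\<exists>p. primitive_prime p 9" by (rule primitive_primeI[of 17]) auto
  moreover have "\<exists>p. primitive_prime p 10" by (rule primitive_primeI[of 11]) auto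
  moreover have "\<exists>p. primitive_prime p 11" by (rule primitive_primeI[of 89]) auto
  moreover have "\<exists>p. primitive_prime p 14" by (rule primitive_primeI[of 29]) auto
  moreover have "\<exists>p. primitive_prime p 15" by (rule primitive_primeI[of 61]) auto
  moreover have "\<exists>p. primitive_prime p 18" by (rule primitive_primeI[of 19]) auto
  moreover have "\<exists>p. primitive_prime p 20" by (rule primitive_primeI[of 41]) auto
  moreover have "\<exists>p. primitive_prime p 30" by (rule primitive_primeI[of 31]) auto
  moreover have "\<exists>p. primitive_prime p 42" by (rule primitive_primeI[of 211]) auto
  ultimately show ?thesis using assms by auto
qed

text \<open>Enumeration over the complementary divisor k = 1260 / n, which is below 97 because 13 *
  97 = 1261.\<close>

lemma dvd_1260_cases:
  assumes "n dvd (1260::nat)" "n > 12"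
  shows "n \<in> {14,15,18,20,30,42} \<or>
    (\<exists>m\<in>{8,25,50,27,54,49,98,21,28,36,35,45,60,70,90,126}. m dvd n \<and> (even m \<or> odd n))"
proof -
  obtain k where k: "1260 = n * k" using assms(1) by (rule dvdE)
  have "k < 97"
  proof (rule ccontr)
    assume "\<not> k < 97"
    then have "13 * 97 \<le> n * k" using assms(2) by (intro mult_le_mono) auto
    with k show False by simp
  qed
  then have "k = 0 \<or> k = 1 \<or> k \<in> set [2..<97]" unfolding set_upt atLeastLessThan_iff by linarith
  moreover have "\<forall>k\<in>set [2..<97]. k dvd (1260::nat) \<longrightarrow> k \<in> {2, 3, 4, 5, 6, 7, 9, 10, 12, 14, 15, 18, 20, 21, 28, 30, 35, 36, 42, 45, 60, 63, 70, 84, 90}"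
    by (simp del: set_upt)
  moreover have "k dvd 1260" using k by (metis dvd_triv_right)
  moreover have k0: "k \<noteq> 0" using k by (metis mult_0_right zero_neq_numeral)
  ultimately have kk: "k \<in> {1, 2, 3, 4, 5, 6, 7, 9, 10, 12, 14, 15, 18, 20, 21, 28, 30, 35, 36, 42, 45, 60, 63, 70, 84, 90}" by (metis insertI1 insertI2)
  have n: "n = 1260 div k" using k k0 by (metis nonzero_mult_div_cancel_right)
  show ?thesis unfolding n using kk
    by (elim insertE emptyE; simp)
qed

lemma multiplicity_le_if_not_dvd:
  assumes "p ^ k dvd b" "b \<noteq> 0" "prime p" "\<not> p ^ Suc k dvd n"
  shows "multiplicity p n \<le> multiplicity p (b::nat)"
proof -
  have "multiplicity p n < Suc k" using assms by (metis multiplicity_dvd' not_le)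
  moreover have "k \<le> multiplicity p b"
    using assms by (intro multiplicity_geI) auto
  ultimately show ?thesis by simp
qed

text \<open>If no base case applies, n has no prime factor from 11 on and is divisible by none of 8,
  27, 25, 49, so it divides 1260 = 2^2 3^2 5 7. Odd bases are usable only for odd n; for 25, 27 and
  49 the doubles take over when n is even.\<close>

lemma fib_large_gt_12:
  assumes "n > 12" "n \<notin> {14,15,18,20,30,42}"
  shows "fib_large n"
proof (rule ccontr)
  assume contra: "\<not> fib_large n"
  have no: "\<not> m dvd n" if "m \<in> {8,25,50,27,54,49,98,21,28,36,35,45,60,70,90,126}" "even m \<or> odd n" for m
  proof
    assume "m dvd n"
    moreover have "fib_large m" using fib_large_numerals that by blast
    moreover have "m > 1" using that by auto
    ultimately show False using fib_large_multI that contra assms(1) by auto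
  qed
  have n0: "n > 0" using assms by simp
  have big: "\<not> p dvd n" if p: "prime p" "p \<ge> 11" for p
  proof
    assume pn: "p dvd n"
    show False
    proof (cases "even n")
      case True
      have "coprime 2 p" using p by (simp add: prime_odd_nat)
      then have "2 * p dvd n" using True pn by (simp add: divides_mult)
      then show False using fib_large_multI[OF fib_large_prime(2)[OF p]] contra n0 p by auto
    next
      case False
      then show False using fib_large_multI[OF fib_large_prime(1)[OF p] pn] contra n0 p by auto
    qed
  qed
  have evod: "\<not> q dvd n" if "odd q" "q \<in> {25,27,49}" for q
  proof
    assume q: "q dvd n"
    show False
    proof (cases "even n")
      case True
      have "2 * q dvd n" using True q that by (intro divides_mult) auto
      then show False using no[of "2*q"] that by auto
    next
      case False
      then show False using no[of q] that q by auto
    qed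
  qed
  have "n dvd 1260"
  proof (rule multiplicity_le_imp_dvd)
    fix p :: nat assume p: "prime p"
    show "multiplicity p n \<le> multiplicity p 1260"
    proof (cases "p \<in> {2,3,5,7}")
      case True
      then consider "p = 2" | "p = 3" | "p = 5" | "p = 7" by auto
      then show ?thesis
      proof cases
        case 1 then show ?thesis using multiplicity_le_if_not_dvd[of 2 2 1260 n] no[of 8] by simp
      next
        case 2 then show ?thesis using multiplicity_le_if_not_dvd[of 3 2 1260 n] evod[of 27] by simp
      next
        case 3 then show ?thesis using multiplicity_le_if_not_dvd[of 5 1 1260 n] evod[of 25] by simp
      next
        case 4 then show ?thesis using multiplicity_le_if_not_dvd[of 7 1 1260 n] evod[of 49] by simp
      qed
    next
      case False
      have "p \<ge> 11"
      proof (rule ccontr)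
        assume "\<not> p \<ge> 11"
        then have "p \<in> set [2..<11]" using prime_ge_2_nat[OF p] unfolding set_upt atLeastLessThan_iff by linarith
        then show False using False p by (simp del: set_upt) (elim disjE; simp)
      qed
      then show ?thesis using big[OF p] by (simp add: not_dvd_imp_multiplicity_0)
    qed
  qed (use n0 in simp)
  then show False using dvd_1260_cases[of n] assms no by blast
qed

theorem exists_primitive_prime:
  assumes "n > 2" "n \<noteq> 6" "n \<noteq> 12"
  shows "\<exists>p. primitive_prime p n"
proof (cases "n \<in> {3,4,5,7,8,9,10,11,14,15,18,20,30,42}")
  case True
  then show ?thesis by (rule primitive_prime_small)
next
  case False
  have "n > 12"
  proof (rule ccontr)
    assume "\<not> n > 12"
    then have "n \<in> set [3..<13]" using assms unfolding set_upt atLeastLessThan_iff by linarith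
    then show False using False assms by (simp del: set_upt)
  qed
  then show ?thesis using False by (intro primitive_prime_if_large fib_large_gt_12) auto
qed

section \<open>Kronecker approximation for logarithms of Fibonacci numbers\<close>

definition carmichael_indices :: "nat set" where
  "carmichael_indices = {3..} - {6, 12}"

text \<open>Kronecker's theorem is applied to an indexed family whose set of values is independent,
  so repetitions must be excluded.\<close>

lemma ln_fib_inj: "inj_on (\<lambda>n. ln (real (fib n))) carmichael_indices"
proof (rule linorder_inj_onI)
  fix a b assume ab: "a < b" "a \<in> carmichael_indices" "b \<in> carmichael_indices"
  then obtain p where p: "primitive_prime p b"
    using exists_primitive_prime[of b] by (auto simp: carmichael_indices_def)
  have "0 < a" using ab by (auto simp: carmichael_indices_def)
  then have "\<not> p dvd fib a" "p dvd fib b" using p ab by (auto simp: primitive_prime_def)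
  then have "fib a \<noteq> fib b" by auto
  then show "ln (real (fib a)) \<noteq> ln (real (fib b))"
    using fib_neq_0_nat[of a] fib_neq_0_nat[of b] \<open>0 < a\<close> ab by simp
qed auto

text \<open>Let m be the largest index with nonzero coefficient. A primitive prime of F_m divides no
  earlier F_j, so its valuation isolates the coefficient at m.\<close>

lemma ln_fib_independent:
  fixes k :: "nat \<Rightarrow> int"
  assumes "finite S" "S \<subseteq> carmichael_indices" "(\<Sum>n\<in>S. of_int (k n) * ln (real (fib n))) = 0"
    and "n \<in> S"
  shows "k n = 0"
proof (rule ccontr)
  assume "k n \<noteq> 0"
  define m where "m = Max {n\<in>S. k n \<noteq> 0}"
  have "m \<in> {n\<in>S. k n \<noteq> 0}"
    unfolding m_def using assms \<open>k n \<noteq> 0\<close> by (intro Max_in) auto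
  then have m: "m \<in> S" "k m \<noteq> 0" by auto
  have mx: "k j = 0" if "j \<in> S" "j > m" for j
  proof (rule ccontr)
    assume "k j \<noteq> 0"
    then have "j \<le> m" unfolding m_def using that assms(1) by (intro Max_ge) auto
    then show False using that by simp
  qed
  have idx: "j > 2 \<and> j \<noteq> 6 \<and> j \<noteq> 12" if "j \<in> S" for j
    using subsetD[OF assms(2) that] by (auto simp: carmichael_indices_def)
  obtain p where p: "primitive_prime p m"
    using exists_primitive_prime[of m] idx[OF m(1)] by blast
  then have pp: "prime p" by (simp add: primitive_prime_def)
  have pos: "fib j > 0" if "j \<in> S" for j
    using idx[OF that] by (intro fib_neq_0_nat) auto
  \<comment> \<open>Positive and negative coefficients go to different products, so the relation
    becomes the equality \<open>A = B\<close> of natural numbers.\<close>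
  define A where "A = (\<Prod>j\<in>S. fib j ^ nat (k j))"
  define B where "B = (\<Prod>j\<in>S. fib j ^ nat (- k j))"
  have AB: "A > 0" "B > 0" using pos by (auto simp: A_def B_def intro!: prod_pos)
  have sp: "real_of_int (k j) = real (nat (k j)) - real (nat (- k j))" for j
    by (cases "k j \<ge> 0") auto
  have "ln (real A) = (\<Sum>j\<in>S. real (nat (k j)) * ln (real (fib j)))"
    unfolding A_def of_nat_prod using pos by (subst ln_prod) (auto simp: assms(1) ln_realpow intro!: sum.cong)
  moreover have "ln (real B) = (\<Sum>j\<in>S. real (nat (- k j)) * ln (real (fib j)))"
    unfolding B_def of_nat_prod using pos by (subst ln_prod) (auto simp: assms(1) ln_realpow intro!: sum.cong)
  ultimately have "ln (real A) - ln (real B) = (\<Sum>j\<in>S. of_int (k j) * ln (real (fib j)))"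
    by (simp add: sp left_diff_distrib sum_subtractf)
  then have "A = B" using AB assms(3) by simp
  have mult: "multiplicity p (\<Prod>j\<in>S. fib j ^ c j) = c m * multiplicity p (fib m)"
    if c: "\<And>j. j \<in> S \<Longrightarrow> j > m \<Longrightarrow> c j = 0" for c :: "nat \<Rightarrow> nat"
  proof -
    have "multiplicity p (\<Prod>j\<in>S. fib j ^ c j) = (\<Sum>j\<in>S. multiplicity p (fib j ^ c j))"
      using pos assms(1) pp by (intro prime_elem_multiplicity_prod_distrib) (auto simp: image_iff)
    also have "\<dots> = (\<Sum>j\<in>S. if j = m then c m * multiplicity p (fib m) else 0)"
    proof (intro sum.cong refl)
      fix j assume j: "j \<in> S"
      have "j > 0" using idx[OF j] by simp
      have "multiplicity p (fib j ^ c j) = c j * multiplicity p (fib j)"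
        using pos[OF j] pp by (intro prime_elem_multiplicity_power_distrib) auto
      moreover have "multiplicity p (fib j) = 0" if "j < m"
        using p that \<open>j > 0\<close> by (intro not_dvd_imp_multiplicity_0) (auto simp: primitive_prime_def)
      ultimately show "multiplicity p (fib j ^ c j) = (if j = m then c m * multiplicity p (fib m) else 0)"
        using c[OF j] by (cases j m rule: linorder_cases) auto
    qed
    finally show ?thesis using m assms(1) by simp
  qed
  have "nat (k m) * multiplicity p (fib m) = nat (- k m) * multiplicity p (fib m)"
    using mult[of "\<lambda>j. nat (k j)"] mult[of "\<lambda>j. nat (- k j)"] mx \<open>A = B\<close> by (auto simp: A_def B_def)
  moreover have "multiplicity p (fib m) > 0"
    using p pos[OF m(1)] by (auto simp: primitive_prime_def prime_multiplicity_gt_zero_iff)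
  ultimately show False using m(2) by simp
qed

lemma Kronecker_fib:
  fixes z :: "nat \<Rightarrow> complex"
  assumes "finite S" "S \<subseteq> carmichael_indices" "\<And>n. n \<in> S \<Longrightarrow> norm (z n) = 1"
  obtains t :: "nat \<Rightarrow> real" where "\<And>n. n \<in> S \<Longrightarrow> (\<lambda>k. cis (t k * ln (real (fib n)))) \<longlonglongrightarrow> z n"
proof -
  \<comment> \<open>With this scalar multiplication \<open>independent\<close> means linear
    independence over the integers.\<close>
  interpret Modules.module "(\<lambda>r. (*) (real_of_int r))"
    by (simp add: Modules.module.intro distrib_left mult.commute)
  obtain e where e: "bij_betw e {..<card S} S"
    using ex_bij_betw_nat_finite[OF assms(1)] by (auto simp: lessThan_atLeast0)
  define l where "l = (\<lambda>n. ln (real (fib n)))"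
  have inj: "inj_on l S" unfolding l_def using ln_fib_inj assms(2) by (rule inj_on_subset)
  have inj': "inj_on (l \<circ> e) {..<card S}"
    using e inj by (auto simp: bij_betw_def intro: comp_inj_on)
  have "independent (l ` S)"
    unfolding dependent_explicit
  proof (rule notI, elim exE conjE bexE)
    fix T u v assume T: "finite T" "T \<subseteq> l ` S" "(\<Sum>v\<in>T. real_of_int (u v) * v) = 0" "v \<in> T" "u v \<noteq> 0"
    define S' where "S' = {n \<in> S. l n \<in> T}"
    have im: "T = l ` S'" using T by (auto simp: S'_def)
    have "inj_on l S'" using inj by (rule inj_on_subset) (auto simp: S'_def)
    then have "(\<Sum>n\<in>S'. real_of_int (u (l n)) * l n) = 0"
      using T(3) unfolding im by (simp add: sum.reindex)
    then have "u (l n) = 0" if "n \<in> S'" for n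
      using that assms ln_fib_independent[of S' "\<lambda>n. u (l n)" n] by (auto simp: l_def S'_def)
    then show False using T(4,5) unfolding im by auto
  qed
  then have indep: "independent ((l \<circ> e) ` {..<card S})"
    using e by (metis bij_betw_imp_surj_on image_comp)
  \<comment> \<open>Kronecker's theorem works modulo 1, so phases are measured in full turns and
    \<open>t\<close> is rescaled by \<open>2 * pi\<close> at the end.\<close>
  define \<alpha> where "\<alpha> = (\<lambda>i. Arg (z (e i)) / (2 * pi))"
  have "\<exists>t h. \<forall>i<card S. \<bar>t * (l \<circ> e) i - of_int (h i) - \<alpha> i\<bar> < inverse (real (Suc k))" for k
    by (rule Kronecker_thm_1[OF indep inj', of "inverse (real (Suc k))" \<alpha>]) auto
  then obtain t h where th: "\<And>k i. i < card S \<Longrightarrow> \<bar>t k * (l \<circ> e) i - of_int (h k i) - \<alpha> i\<bar> < inverse (real (Suc k))"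
    by metis
  show thesis
  proof (rule that[of "\<lambda>k. 2 * pi * t k"])
    fix n assume n: "n \<in> S"
    then obtain i where i: "i < card S" "n = e i" using e by (auto simp: bij_betw_def)
    define x where "x = (\<lambda>k. t k * l n - of_int (h k i))"
    have "(\<lambda>k. x k - \<alpha> i) \<longlonglongrightarrow> 0"
      by (rule Lim_null_comparison[OF _ LIMSEQ_inverse_real_of_nat])
        (use th[OF i(1)] in \<open>auto simp: x_def i(2) less_imp_le intro!: always_eventually\<close>)
    then have "x \<longlonglongrightarrow> \<alpha> i" by (simp add: LIM_zero_iff)
    then have "(\<lambda>k. cis (2 * pi * x k)) \<longlonglongrightarrow> cis (2 * pi * \<alpha> i)" by (intro tendsto_intros)
    moreover have "cis (2 * pi * x k) = cis (2 * pi * t k * ln (real (fib n)))" for k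
    proof -
      have "2 * pi * t k * ln (real (fib n)) = 2 * pi * x k + 2 * pi * of_int (h k i)"
        by (simp add: x_def l_def algebra_simps)
      then show ?thesis by (simp add: cis_mult[symmetric])
    qed
    moreover have "cis (2 * pi * \<alpha> i) = z n"
      using assms(3)[OF n] rcis_cmod_Arg[of "z n"] by (simp add: \<alpha>_def i(2)[symmetric] rcis_def)
    ultimately show "(\<lambda>k. cis (2 * pi * t k * ln (real (fib n)))) \<longlonglongrightarrow> z n" by simp
  qed
qed

section \<open>The threshold abscissae\<close>

definition fib_wt :: "nat \<Rightarrow> real \<Rightarrow> real" where
  "fib_wt n \<sigma> = real (fib n) powr (- \<sigma>)"

text \<open>
  The terms \<open>n = 1, 2\<close> are included in the sum, so \<open>2 - 4 = -2\<close>, and the double subtraction turns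
  the contribution of \<open>n = 12\<close> into \<open>-144\<^sup>-\<^sup>\<sigma>\<close>.
\<close>
definition excess :: "nat \<Rightarrow> real \<Rightarrow> real" where
  "excess N \<sigma> = (\<Sum>n=1..N. fib_wt n \<sigma>) - 4 - 2 * fib_wt 12 \<sigma>"

lemma fib_vals: "fib 3 = 2" "fib 4 = 3" "fib 5 = 5" "fib 6 = 8" "fib 7 = 13" "fib 8 = 21"
  "fib 9 = 34" "fib 10 = 55" "fib 11 = 89" "fib 12 = 144" "fib 13 = 233"
  by code_simp+

lemma fib_pos [simp]: "fib n > 0 \<longleftrightarrow> n > 0"
  using fib_neq_0_nat[of n] by (cases n) auto

lemma fib_wt_pos: "n > 0 \<Longrightarrow> fib_wt n \<sigma> > 0"
  by (simp add: fib_wt_def)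

lemma fib_wt_antimono: "n > 0 \<Longrightarrow> \<sigma> \<le> \<tau> \<Longrightarrow> fib_wt n \<tau> \<le> fib_wt n \<sigma>"
proof -
  assume "n > 0" "\<sigma> \<le> \<tau>"
  then have "fib n \<ge> 1" by (simp add: Suc_leI)
  then show ?thesis unfolding fib_wt_def using \<open>\<sigma> \<le> \<tau>\<close> by (intro powr_mono) auto
qed

lemma fib_wt_mono_index: "0 < m \<Longrightarrow> m \<le> n \<Longrightarrow> \<sigma> \<ge> 0 \<Longrightarrow> fib_wt n \<sigma> \<le> fib_wt m \<sigma>"
  unfolding fib_wt_def by (intro powr_mono2') (auto simp: fib_mono)

lemma Z_FN_of_real: "Z_FN N (of_real \<sigma>) = of_real (\<Sum>n=1..N. fib_wt n \<sigma>)"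
  unfolding Z_FN_def fib_wt_def of_real_sum
  by (intro sum.cong refl) (simp flip: powr_of_real of_real_minus)

lemma powr_144: "144 powr (- of_real \<sigma>) = (of_real (fib_wt 12 \<sigma>) :: complex)"
  using powr_of_real[of 144 "-\<sigma>"] by (simp add: fib_wt_def fib_vals)

lemma threshold_iff_excess:
  "Z_FN N (of_real \<sigma>) = 4 + 2 * 144 powr (- of_real \<sigma>) \<longleftrightarrow> excess N \<sigma> = 0"
proof -
  have "Z_FN N (of_real \<sigma>) - (4 + 2 * 144 powr (- of_real \<sigma>)) = of_real (excess N \<sigma>)"
    unfolding Z_FN_of_real powr_144 excess_def by simp
  then show ?thesis by (metis eq_iff_diff_eq_0 of_real_eq_0_iff)
qed

lemma excess_12: "excess 12 \<sigma> = fib_wt 3 \<sigma> + fib_wt 4 \<sigma> + fib_wt 5 \<sigma> + fib_wt 6 \<sigma> + fib_wt 7 \<sigma>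
   + fib_wt 8 \<sigma> + fib_wt 9 \<sigma> + fib_wt 10 \<sigma> + fib_wt 11 \<sigma> - fib_wt 12 \<sigma> - 2"
proof -
  have "fib_wt (Suc 0) \<sigma> = 1" "fib_wt (Suc (Suc 0)) \<sigma> = 1" by (simp_all add: fib_wt_def)
  then show ?thesis by (simp add: excess_def numeral_eq_Suc)
qed

lemma excess_split: "N \<ge> 12 \<Longrightarrow> excess N \<sigma> = excess 12 \<sigma> + (\<Sum>n\<in>{13..N}. fib_wt n \<sigma>)"
proof -
  assume "N \<ge> 12"
  then have "{1..N} = {1..12} \<union> {13..N}" by auto
  then have "(\<Sum>n=1..N. fib_wt n \<sigma>) = (\<Sum>n=1..12. fib_wt n \<sigma>) + (\<Sum>n\<in>{13..N}. fib_wt n \<sigma>)"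
    by (simp add: sum.union_disjoint)
  then show ?thesis by (simp add: excess_def)
qed

lemma excess_Suc: "excess (Suc N) \<sigma> = excess N \<sigma> + fib_wt (Suc N) \<sigma>"
  by (simp add: excess_def)

text \<open>
  With \<open>x = 2\<^sup>-\<^sup>\<sigma>\<close> and \<open>y = 3\<^sup>-\<^sup>\<sigma>\<close> the only negative term \<open>-144\<^sup>-\<^sup>\<sigma>\<close> is \<open>- x\<^sup>4 y\<^sup>2\<close>.
\<close>
lemma core_poly_mono:
  fixes x y u v :: real
  assumes "0 < u" "u < x" "0 < v" "v < y" "x\<^sup>2 \<le> 1/2" "y\<^sup>2 \<le> 1/3"
  shows "u + v - u ^ 4 * v\<^sup>2 < x + y - x ^ 4 * y\<^sup>2"
proof -
  have "u\<^sup>2 \<le> x\<^sup>2" using assms by (intro power_mono) auto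
  then have u2: "u\<^sup>2 \<le> 1/2" using assms(5) by linarith
  have x1: "x < 3/4"
    using assms(5) power_mono[of "3/4" x 2] by (cases "x < 3/4") (auto simp: power_divide)
  have y1: "y < 3/5"
    using assms(6) power_mono[of "3/5" y 2] by (cases "y < 3/5") (auto simp: power_divide)
  have "x ^ 4 - u ^ 4 = (x - u) * ((x + u) * (x\<^sup>2 + u\<^sup>2))" by (simp add: algebra_simps power4_eq_xxxx power2_eq_square)
  also have "\<dots> \<le> (x - u) * ((3/2) * 1)"
    using assms u2 x1 by (intro mult_left_mono mult_mono) auto
  finally have 1: "x ^ 4 - u ^ 4 \<le> 3/2 * (x - u)" by simp
  have "y\<^sup>2 - v\<^sup>2 = (y - v) * (y + v)" by (simp add: algebra_simps power4_eq_xxxx power2_eq_square)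
  also have "\<dots> \<le> (y - v) * (6/5)" using assms y1 by (intro mult_left_mono) auto
  finally have 2: "y\<^sup>2 - v\<^sup>2 \<le> 6/5 * (y - v)" by simp
  have u4: "u ^ 4 \<le> 1/4" using power_mono[OF u2, of 2] by (simp add: power_divide)
  \<comment> \<open>Changing one variable at a time bounds the increment of x^4 y^2 by (x - u) / 2 +
    3 (y - v) / 10.\<close>
  have "x ^ 4 * y\<^sup>2 - u ^ 4 * v\<^sup>2 = (x ^ 4 - u ^ 4) * y\<^sup>2 + u ^ 4 * (y\<^sup>2 - v\<^sup>2)" by (simp add: algebra_simps power4_eq_xxxx power2_eq_square)
  also have "\<dots> \<le> (3/2 * (x - u)) * (1/3) + (1/4) * (6/5 * (y - v))"
    using 1 2 assms u4 by (intro add_mono mult_mono) (auto intro: power_mono)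
  also have "\<dots> < (x - u) + (y - v)"
  proof -
    have "3/2 * d * (1/3) + 1/4 * (6/5 * e) < d + e" if "d > 0" "e > 0" for d e :: real
      using that by simp
    from this[of "x - u" "y - v"] show ?thesis using assms(2,4) by simp
  qed
  finally show ?thesis by simp
qed

text \<open>The bound 1/2 on \<sigma> makes the squares of 2^(-\<sigma>) and 3^(-\<sigma>) at most
  1/2 and 1/3, as \<open>core_poly_mono\<close> requires; the terms at indices 5 to 11 decrease by
  themselves.\<close>

lemma excess_12_strict_antimono:
  assumes "1/2 \<le> \<sigma>" "\<sigma> < \<tau>"
  shows "excess 12 \<tau> < excess 12 \<sigma>"
proof -
  have w12: "fib_wt 12 s = fib_wt 3 s ^ 4 * (fib_wt 4 s)\<^sup>2" for s
  proof -
    have "144 powr (-s) = 16 powr (-s) * 9 powr (-s)" using powr_mult[of 16 9 "-s"] by simp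
    moreover have "16 powr (-s) = 4 powr (-s) * 4 powr (-s)" using powr_mult[of 4 4 "-s"] by simp
    moreover have "4 powr (-s) = 2 powr (-s) * 2 powr (-s)" using powr_mult[of 2 2 "-s"] by simp
    moreover have "9 powr (-s) = 3 powr (-s) * 3 powr (-s)" using powr_mult[of 3 3 "-s"] by simp
    ultimately show ?thesis by (simp add: fib_wt_def fib_vals power4_eq_xxxx power2_eq_square)
  qed
  have sq: "(fib_wt n \<sigma>)\<^sup>2 \<le> 1 / real (fib n)" if "n > 0" for n
  proof -
    have "(fib_wt n \<sigma>)\<^sup>2 = real (fib n) powr (- (2 * \<sigma>))"
      using that by (simp add: fib_wt_def power2_eq_square flip: powr_add)
    also have "\<dots> \<le> real (fib n) powr (-1)"
      using assms that by (intro powr_mono) (auto simp: Suc_leI)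
    finally show ?thesis using that by (simp add: powr_minus_divide)
  qed
  have lt: "fib_wt n \<tau> < fib_wt n \<sigma>" if "fib n > 1" for n
    unfolding fib_wt_def using that assms by (intro powr_less_mono) auto
  have "fib_wt 3 \<tau> + fib_wt 4 \<tau> - fib_wt 12 \<tau> < fib_wt 3 \<sigma> + fib_wt 4 \<sigma> - fib_wt 12 \<sigma>"
    unfolding w12 using sq[of 3] sq[of 4]
    by (intro core_poly_mono lt fib_wt_pos) (auto simp: fib_vals)
  moreover have "fib_wt n \<tau> \<le> fib_wt n \<sigma>" if "n > 0" for n
    using fib_wt_antimono assms that by auto
  from this[of 5] this[of 6] this[of 7] this[of 8] this[of 9] this[of 10] this[of 11]
  have "fib_wt 5 \<tau> + fib_wt 6 \<tau> + fib_wt 7 \<tau> + fib_wt 8 \<tau> + fib_wt 9 \<tau> + fib_wt 10 \<tau> + fib_wt 11 \<tau>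
    \<le> fib_wt 5 \<sigma> + fib_wt 6 \<sigma> + fib_wt 7 \<sigma> + fib_wt 8 \<sigma> + fib_wt 9 \<sigma> + fib_wt 10 \<sigma> + fib_wt 11 \<sigma>"
    by simp
  ultimately show ?thesis unfolding excess_12 by linarith
qed

lemma excess_strict_antimono:
  assumes "N \<ge> 12" "1/2 \<le> \<sigma>" "\<sigma> < \<tau>"
  shows "excess N \<tau> < excess N \<sigma>"
  unfolding excess_split[OF assms(1)]
  by (intro add_less_le_mono excess_12_strict_antimono sum_mono fib_wt_antimono) (use assms in auto)

text \<open>Taking q-th powers reduces a bound on x^(-p/q) to a comparison of rationals. This and
  \<open>powr_minus_leI\<close> yield the decimal estimates below.\<close>

lemma le_powr_minusI:
  fixes x c :: real
  assumes "x > 0" "c > 0" "q > 0" "c ^ q * x ^ p \<le> 1"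
  shows "c \<le> x powr (- (real p / real q))"
proof (rule power_le_imp_le_base)
  have "(x powr (- (real p / real q))) ^ q = x powr (- real p)"
    using assms by (simp add: powr_power)
  also have "\<dots> = 1 / x ^ p" using assms by (simp add: powr_minus_divide powr_realpow)
  also have "\<dots> \<ge> c ^ q" using assms by (simp add: field_simps)
  finally show "c ^ Suc (q - 1) \<le> (x powr (- (real p / real q))) ^ Suc (q - 1)" using assms by simp
qed simp

lemma powr_minus_leI:
  fixes x c :: real
  assumes "x > 0" "c > 0" "q > 0" "c ^ q * x ^ p \<ge> 1"
  shows "x powr (- (real p / real q)) \<le> c"
proof (rule power_le_imp_le_base)
  have "(x powr (- (real p / real q))) ^ q = x powr (- real p)"
    using assms by (simp add: powr_power)
  also have "\<dots> = 1 / x ^ p" using assms by (simp add: powr_minus_divide powr_realpow)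
  also have "\<dots> \<le> c ^ q" using assms by (simp add: field_simps)
  finally show "(x powr (- (real p / real q))) ^ Suc (q - 1) \<le> c ^ Suc (q - 1)" using assms by simp
qed (use assms in simp)

text \<open>The listed bounds leave a margin of 0.0132. The point 0.72 has to lie below
  \<open>sigma_FN 12\<close> and yet be large enough for \<open>fib_wt_12_trade_off\<close>.\<close>

lemma excess_12_pos_18_25: "excess 12 (18/25) > 0"
proof -
  have lo: "c \<le> x powr (-(18/25))" if "x > 0" "c > 0" "c ^ 25 * x ^ 18 \<le> 1" for x c :: real
    using le_powr_minusI[of x c 25 18] that by simp
  have "144 powr (-(18/25)) \<le> (280/10000::real)"
    using powr_minus_leI[of 144 "280/10000" 25 18] by (simp add: power_divide)
  moreover have "6070/10000 \<le> 2 powr (-(18/25)::real)" by (rule lo) (simp_all add: power_divide)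
  moreover have "4533/10000 \<le> 3 powr (-(18/25)::real)" by (rule lo) (simp_all add: power_divide)
  moreover have "3138/10000 \<le> 5 powr (-(18/25)::real)" by (rule lo) (simp_all add: power_divide)
  moreover have "2237/10000 \<le> 8 powr (-(18/25)::real)" by (rule lo) (simp_all add: power_divide)
  moreover have "1577/10000 \<le> 13 powr (-(18/25)::real)" by (rule lo) (simp_all add: power_divide)
  moreover have "1116/10000 \<le> 21 powr (-(18/25)::real)" by (rule lo) (simp_all add: power_divide)
  moreover have "789/10000 \<le> 34 powr (-(18/25)::real)" by (rule lo) (simp_all add: power_divide)
  moreover have "558/10000 \<le> 55 powr (-(18/25)::real)" by (rule lo) (simp_all add: power_divide)
  moreover have "394/10000 \<le> 89 powr (-(18/25)::real)" by (rule lo) (simp_all add: power_divide)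
  ultimately show ?thesis unfolding excess_12 fib_wt_def fib_vals by simp
qed

lemma excess_12_le_3_4: "excess 12 (3/4) \<le> -778/10000"
proof -
  have hi: "x powr (-(3/4)) \<le> c" if "x > 0" "c > 0" "c ^ 4 * x ^ 3 \<ge> 1" for x c :: real
    using powr_minus_leI[of x c 4 3] that by simp
  have "240/10000 \<le> (144 powr (-(3/4))::real)"
    using le_powr_minusI[of 144 "240/10000" 4 3] by (simp add: power_divide)
  moreover have "2 powr (-(3/4)::real) \<le> 5947/10000" by (rule hi) (simp_all add: power_divide)
  moreover have "3 powr (-(3/4)::real) \<le> 4387/10000" by (rule hi) (simp_all add: power_divide)
  moreover have "5 powr (-(3/4)::real) \<le> 2991/10000" by (rule hi) (simp_all add: power_divide)
  moreover have "8 powr (-(3/4)::real) \<le> 2103/10000" by (rule hi) (simp_all add: power_divide)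
  moreover have "13 powr (-(3/4)::real) \<le> 1461/10000" by (rule hi) (simp_all add: power_divide)
  moreover have "21 powr (-(3/4)::real) \<le> 1020/10000" by (rule hi) (simp_all add: power_divide)
  moreover have "34 powr (-(3/4)::real) \<le> 711/10000" by (rule hi) (simp_all add: power_divide)
  moreover have "55 powr (-(3/4)::real) \<le> 496/10000" by (rule hi) (simp_all add: power_divide)
  moreover have "89 powr (-(3/4)::real) \<le> 346/10000" by (rule hi) (simp_all add: power_divide)
  ultimately show ?thesis unfolding excess_12 fib_wt_def fib_vals by simp
qed

text \<open>The map x -> 1 + 1/x sends [8/5, 5/3] into itself, so the two bounds on consecutive
  ratios feed each other. The range starts at index 4 because F_4 / F_3 = 3/2.\<close>

lemma fib_ratio: "8 * fib (n + 4) \<le> 5 * fib (n + 5) \<and> 3 * fib (n + 5) \<le> 5 * fib (n + 4)"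
proof (induction n)
  case 0
  show ?case by (simp add: fib_vals)
next
  case (Suc n)
  have "fib (n + 6) = fib (n + 5) + fib (n + 4)" by (simp add: numeral_eq_Suc)
  with Suc show ?case by (simp add: add.commute)
qed

lemma fib_wt_geometric:
  assumes "\<sigma> \<ge> 0"
  shows "fib_wt (m + 4 + k) \<sigma> \<le> fib_wt (m + 4) \<sigma> * ((8/5) powr (- \<sigma>)) ^ k"
proof (induction k)
  case (Suc k)
  have "8 * fib (m + k + 4) \<le> 5 * fib (m + k + 5)" using fib_ratio by blast
  then have "real (8 * fib (m + k + 4)) \<le> real (5 * fib (m + k + 5))" by (rule of_nat_mono)
  then have "8/5 * real (fib (m + 4 + k)) \<le> real (fib (m + 4 + Suc k))"
    by (simp add: add.commute add.left_commute numeral_eq_Suc)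
  then have "fib_wt (m + 4 + Suc k) \<sigma> \<le> (8/5 * real (fib (m + 4 + k))) powr (-\<sigma>)"
    unfolding fib_wt_def using assms by (intro powr_mono2') auto
  also have "\<dots> = (8/5) powr (-\<sigma>) * fib_wt (m + 4 + k) \<sigma>" by (simp only: fib_wt_def powr_mult)
  also have "\<dots> \<le> (8/5) powr (-\<sigma>) * (fib_wt (m + 4) \<sigma> * ((8/5) powr (- \<sigma>)) ^ k)"
    using Suc by (intro mult_left_mono) auto
  finally show ?case by (simp add: algebra_simps)
qed simp

lemma summable_fib_wt:
  assumes "\<sigma> > 0"
  shows "summable (\<lambda>n. fib_wt (Suc n) \<sigma>)"
proof -
  have "(8/5) powr (-\<sigma>) < (8/5::real) powr 0" using assms by (intro powr_less_mono) auto
  then have "summable (\<lambda>k. fib_wt 4 \<sigma> * ((8/5) powr (- \<sigma>)) ^ k)"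
    by (intro summable_mult summable_geometric) auto
  then have "summable (\<lambda>k. fib_wt (k + 4) \<sigma>)"
    by (rule summable_comparison_test')
      (use fib_wt_geometric[of \<sigma> 0] assms in \<open>auto simp: add.commute less_imp_le fib_wt_pos\<close>)
  then have "summable (\<lambda>k. fib_wt (Suc (k + 3)) \<sigma>)" by (simp add: numeral_eq_Suc)
  then show ?thesis using summable_iff_shift[of "\<lambda>n. fib_wt (Suc n) \<sigma>" 3] by simp
qed

text \<open>From index 13 on a geometric series bounds the terms by 0.0168 / (1 - 0.703) < 0.057,
  inside the margin 0.0778 of \<open>excess_12_le_3_4\<close>. The gap 0.02 is uniform in N and so
  survives the limit.\<close>

lemma excess_3_4_bound:
  assumes "N \<ge> 12"
  shows "excess N (3/4) \<le> -2/100"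
proof -
  define r where "r = ((8/5) powr (-(3/4)) :: real)"
  have r: "r \<le> 703/1000" unfolding r_def
    using powr_minus_leI[of "8/5" "703/1000" 4 3] by (simp add: power_divide)
  have r0: "r > 0" by (simp add: r_def)
  have w13: "fib_wt 13 (3/4) \<le> 168/10000" unfolding fib_wt_def fib_vals
    using powr_minus_leI[of 233 "168/10000" 4 3] by (simp add: power_divide)
  have "(\<Sum>n\<in>{13..N}. fib_wt n (3/4)) = (\<Sum>k<N-12. fib_wt (9 + 4 + k) (3/4))"
    using assms by (intro sum.reindex_bij_witness[of _ "\<lambda>k. k + 13" "\<lambda>n. n - 13"]) auto
  also have "\<dots> \<le> (\<Sum>k<N-12. fib_wt 13 (3/4) * r ^ k)"
    using fib_wt_geometric[of "3/4" 9] by (intro sum_mono) (simp add: r_def)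
  also have "\<dots> = fib_wt 13 (3/4) * (\<Sum>k<N-12. r ^ k)" by (simp add: sum_distrib_left)
  also have "(\<Sum>k<N-12. r ^ k) \<le> 1 / (1 - r)"
    using r r0 by (simp add: sum_gp_strict divide_right_mono)
  also have "1 / (1 - r) \<le> 1 / (1 - 703/1000)" using r by (intro divide_left_mono) auto
  also have "fib_wt 13 (3/4) * (1 / (1 - 703/1000)) \<le> 168/10000 * (1 / (1 - 703/1000))"
    using w13 by (intro mult_right_mono) auto
  finally have "(\<Sum>n\<in>{13..N}. fib_wt n (3/4)) \<le> 168/10000 * (1 / (1 - 703/1000))"
    using fib_wt_pos[of 13 "3/4"] by (simp add: mult_left_mono)
  then show ?thesis using excess_12_le_3_4 unfolding excess_split[OF assms] by simp
qed

lemma excess_pos_18_25: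
  assumes "N \<ge> 12"
  shows "excess N (18/25) > 0"
proof -
  have "(\<Sum>n\<in>{13..N}. fib_wt n (18/25)) \<ge> 0" by (intro sum_nonneg less_imp_le fib_wt_pos) auto
  then show ?thesis using excess_12_pos_18_25 unfolding excess_split[OF assms] by simp
qed

lemma continuous_on_fib_wt [continuous_intros]: "n > 0 \<Longrightarrow> continuous_on A (fib_wt n)"
  unfolding fib_wt_def by (intro continuous_intros) auto

lemma continuous_on_excess: "continuous_on A (excess N)"
  unfolding excess_def by (intro continuous_intros) auto

text \<open>Existence comes from the sign change on [18/25, 3/4], uniqueness on the larger interval
  from strict monotonicity.\<close>

lemma sigma_FN_exists:
  assumes "N \<ge> 12"
  shows "\<exists>!\<sigma>. \<sigma> \<in> {1/2<..<3/4} \<and> excess N \<sigma> = 0"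
    and "sigma_FN N \<in> {18/25<..<3/4}" "excess N (sigma_FN N) = 0"
proof -
  have "\<exists>\<sigma>. 18/25 \<le> \<sigma> \<and> \<sigma> \<le> 3/4 \<and> excess N \<sigma> = 0"
    using excess_pos_18_25[OF assms] excess_3_4_bound[OF assms] continuous_on_excess
    by (intro IVT2') auto
  then obtain \<sigma> where s: "18/25 \<le> \<sigma>" "\<sigma> \<le> 3/4" "excess N \<sigma> = 0" by blast
  have "excess N (18/25) \<noteq> 0" "excess N (3/4) \<noteq> 0"
    using excess_pos_18_25[OF assms] excess_3_4_bound[OF assms] by linarith+
  then have "\<sigma> \<noteq> 18/25" "\<sigma> \<noteq> 3/4" using s(3) by metis+
  with s have s': "18/25 < \<sigma>" "\<sigma> < 3/4" by auto
  have uniq: "\<tau> = \<sigma>" if "\<tau> \<in> {1/2<..<3/4}" "excess N \<tau> = 0" for \<tau>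
    using excess_strict_antimono[OF assms, of \<tau> \<sigma>] excess_strict_antimono[OF assms, of \<sigma> \<tau>] that s s'
    by (cases \<tau> \<sigma> rule: linorder_cases) auto
  show "\<exists>!\<sigma>. \<sigma> \<in> {1/2<..<3/4} \<and> excess N \<sigma> = 0"
    by (rule ex1I[of _ \<sigma>]) (use s s' uniq in auto)
  have "sigma_FN N = \<sigma>" unfolding sigma_FN_def threshold_iff_excess
    by (rule the_equality) (use s s' uniq in auto)
  then show "sigma_FN N \<in> {18/25<..<3/4}" "excess N (sigma_FN N) = 0" using s s' by auto
qed

lemma excess_neg_iff:
  assumes "N \<ge> 12" "\<sigma> \<ge> 1/2"
  shows "excess N \<sigma> < 0 \<longleftrightarrow> \<sigma> > sigma_FN N" "excess N \<sigma> > 0 \<longleftrightarrow> \<sigma> < sigma_FN N"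
proof -
  have s: "excess N (sigma_FN N) = 0" "sigma_FN N > 1/2" using sigma_FN_exists(2,3)[OF assms(1)] by auto
  have "excess N \<sigma> < 0" if "\<sigma> > sigma_FN N"
    using excess_strict_antimono[OF assms(1), of "sigma_FN N" \<sigma>] s that by linarith
  moreover have "excess N \<sigma> > 0" if "\<sigma> < sigma_FN N"
    using excess_strict_antimono[OF assms(1), of \<sigma> "sigma_FN N"] s that assms(2) by linarith
  ultimately show "excess N \<sigma> < 0 \<longleftrightarrow> \<sigma> > sigma_FN N" "excess N \<sigma> > 0 \<longleftrightarrow> \<sigma> < sigma_FN N"
    using s(1) by (metis less_asym linorder_neqE)+
qed

text \<open>Monotonicity is established only from 1/2 on. Below 1/2 the terms at 2, 3, 5, 8, 13 are
  at least their values at 1/2, which already exceed 2.1 > 2, and the term at 89 absorbs the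
  negative one at 144.\<close>

lemma excess_pos:
  assumes "N \<ge> 12" "0 < \<sigma>" "\<sigma> < sigma_FN N"
  shows "excess N \<sigma> > 0"
proof (cases "\<sigma> \<ge> 1/2")
  case True
  then show ?thesis using excess_neg_iff assms by blast
next
  case False
  have w: "fib_wt n (1/2) \<le> fib_wt n \<sigma>" if "n > 0" for n
    using that False by (intro fib_wt_antimono) auto
  have lo: "c \<le> x powr (-(1/2))" if "x > 0" "c > 0" "c ^ 2 * x ^ 1 \<le> 1" for x c :: real
    using le_powr_minusI[of x c 2 1] that by simp
  have "7/10 \<le> 2 powr (-(1/2)::real)" "5/10 \<le> 3 powr (-(1/2)::real)" "4/10 \<le> 5 powr (-(1/2)::real)"
    "3/10 \<le> 8 powr (-(1/2)::real)" "2/10 \<le> 13 powr (-(1/2)::real)"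
    by (rule lo; simp add: power_divide)+
  moreover have "fib_wt 12 \<sigma> \<le> fib_wt 11 \<sigma>" using assms by (intro fib_wt_mono_index) auto
  ultimately have "excess 12 \<sigma> > 0" unfolding excess_12
    using w[of 3] w[of 4] w[of 5] w[of 6] w[of 7] fib_wt_pos[of 8 \<sigma>] fib_wt_pos[of 9 \<sigma>] fib_wt_pos[of 10 \<sigma>]
    unfolding fib_wt_def[of _ "1/2"] fib_vals by simp
  moreover have "(\<Sum>n\<in>{13..N}. fib_wt n \<sigma>) \<ge> 0" by (intro sum_nonneg less_imp_le fib_wt_pos) auto
  ultimately show ?thesis unfolding excess_split[OF assms(1)] by simp
qed

text \<open>Passing from N to N + 1 adds a positive term, so the excess at \<open>sigma_FN N\<close>
  becomes positive and the zero moves to the right.\<close>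

lemma strict_mono_sigma_FN: "strict_mono_on {12..} sigma_FN"
proof -
  have step: "sigma_FN N < sigma_FN (Suc N)" if "N \<ge> 12" for N
  proof -
    have "excess (Suc N) (sigma_FN N) > 0"
      using sigma_FN_exists(3)[OF that] fib_wt_pos[of "Suc N" "sigma_FN N"] by (simp add: excess_Suc)
    then show ?thesis using excess_neg_iff(2)[of "Suc N" "sigma_FN N"] sigma_FN_exists(2)[OF that] that by auto
  qed
  have "sigma_FN m < sigma_FN (m + Suc k)" if "m \<ge> 12" for m k
  proof (induction k)
    case (Suc k)
    then show ?case using step[of "m + Suc k"] that by simp
  qed (use step that in simp)
  note less = this
  show ?thesis
  proof (rule strict_mono_onI)
    fix m n :: nat assume "m \<in> {12..}" "m < n"
    then obtain k where "n = Suc (m + k)" using less_imp_Suc_add by blast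
    then show "sigma_FN m < sigma_FN n" using less[of m k] \<open>m \<in> {12..}\<close> by simp
  qed
qed

section \<open>The limit threshold\<close>

definition excess_lim :: "real \<Rightarrow> real" where
  "excess_lim \<sigma> = (\<Sum>n. fib_wt (Suc n) \<sigma>) - 4 - 2 * fib_wt 12 \<sigma>"

lemma Z_F_of_real:
  assumes "\<sigma> > 0"
  shows "Z_F (of_real \<sigma>) = of_real (\<Sum>n. fib_wt (Suc n) \<sigma>)"
proof -
  have *: "of_nat (fib (Suc n)) powr (- of_real \<sigma>) = (of_real (fib_wt (Suc n) \<sigma>) :: complex)" for n
    unfolding fib_wt_def by (simp flip: powr_of_real of_real_minus)
  show ?thesis unfolding Z_F_def by (simp only: * suminf_of_real[OF summable_fib_wt[OF assms]])
qed

lemma threshold_iff_excess_lim: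
  assumes "\<sigma> > 0"
  shows "Z_F (of_real \<sigma>) = 4 + 2 * 144 powr (- of_real \<sigma>) \<longleftrightarrow> excess_lim \<sigma> = 0"
proof -
  have "Z_F (of_real \<sigma>) - (4 + 2 * 144 powr (- of_real \<sigma>)) = of_real (excess_lim \<sigma>)"
    unfolding Z_F_of_real[OF assms] powr_144 excess_lim_def by simp
  then show ?thesis by (metis eq_iff_diff_eq_0 of_real_eq_0_iff)
qed

lemma excess_eq_lessThan: "excess N \<sigma> = (\<Sum>n<N. fib_wt (Suc n) \<sigma>) - 4 - 2 * fib_wt 12 \<sigma>"
proof -
  have "(\<Sum>n=1..N. fib_wt n \<sigma>) = (\<Sum>n<N. fib_wt (Suc n) \<sigma>)"
    by (intro sum.reindex_bij_witness[of _ Suc "\<lambda>n. n - 1"]) auto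
  then show ?thesis by (simp add: excess_def)
qed

lemma excess_tendsto:
  assumes "\<sigma> > 0"
  shows "(\<lambda>N. excess N \<sigma>) \<longlonglongrightarrow> excess_lim \<sigma>"
  unfolding excess_eq_lessThan excess_lim_def
  by (intro tendsto_intros summable_LIMSEQ summable_fib_wt assms)

lemma excess_less_lim:
  assumes "\<sigma> > 0"
  shows "excess N \<sigma> < excess_lim \<sigma>"
proof -
  have "excess N \<sigma> < excess (Suc N) \<sigma>" by (simp add: excess_Suc fib_wt_pos)
  also have "incseq (\<lambda>N. excess N \<sigma>)"
    by (intro incseq_SucI) (simp add: excess_Suc fib_wt_pos less_imp_le)
  then have "excess (Suc N) \<sigma> \<le> excess_lim \<sigma>"
    using excess_tendsto[OF assms] by (rule incseq_le)
  finally show ?thesis .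
qed

text \<open>A limit preserves only weak inequalities. It is therefore taken of the tails alone, and
  strictness comes from the first twelve terms.\<close>

lemma excess_lim_strict_antimono:
  assumes "1/2 \<le> \<sigma>" "\<sigma> < \<tau>"
  shows "excess_lim \<tau> < excess_lim \<sigma>"
proof -
  have "excess_lim \<tau> - excess 12 \<tau> \<le> excess_lim \<sigma> - excess 12 \<sigma>"
  proof (rule LIMSEQ_le)
    show "(\<lambda>N. excess N \<tau> - excess 12 \<tau>) \<longlonglongrightarrow> excess_lim \<tau> - excess 12 \<tau>"
      "(\<lambda>N. excess N \<sigma> - excess 12 \<sigma>) \<longlonglongrightarrow> excess_lim \<sigma> - excess 12 \<sigma>"
      using assms by (intro tendsto_intros excess_tendsto; simp)+
    show "\<exists>M. \<forall>N\<ge>M. excess N \<tau> - excess 12 \<tau> \<le> excess N \<sigma> - excess 12 \<sigma>"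
    proof (intro exI[of _ 12] allI impI)
      fix N :: nat assume N: "N \<ge> 12"
      have "(\<Sum>n\<in>{13..N}. fib_wt n \<tau>) \<le> (\<Sum>n\<in>{13..N}. fib_wt n \<sigma>)"
        using assms by (intro sum_mono fib_wt_antimono) auto
      then show "excess N \<tau> - excess 12 \<tau> \<le> excess N \<sigma> - excess 12 \<sigma>"
        unfolding excess_split[OF N] by simp
    qed
  qed
  with excess_12_strict_antimono[OF assms] show ?thesis by simp
qed

lemma continuous_on_excess_lim: "continuous_on {7/10..3/4} excess_lim"
proof -
  have "uniform_limit {7/10..3/4} (\<lambda>N \<sigma>. \<Sum>n<N. fib_wt (Suc n) \<sigma>) (\<lambda>\<sigma>. \<Sum>n. fib_wt (Suc n) \<sigma>) sequentially"
  proof (rule Weierstrass_m_test)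
    show "summable (\<lambda>n. fib_wt (Suc n) (7/10))" by (rule summable_fib_wt) simp
    show "norm (fib_wt (Suc n) \<sigma>) \<le> fib_wt (Suc n) (7/10)" if "\<sigma> \<in> {7/10..3/4}" for n \<sigma>
      using that by (simp add: fib_wt_pos less_imp_le fib_wt_antimono)
  qed
  then have "continuous_on {7/10..3/4} (\<lambda>\<sigma>. \<Sum>n. fib_wt (Suc n) \<sigma>)"
    by (rule uniform_limit_theorem[rotated]) (auto intro!: always_eventually continuous_intros)
  then show ?thesis unfolding excess_lim_def by (intro continuous_intros) auto
qed

lemma sigma_F_properties: "sigma_F \<in> {7/10<..<3/4}" "excess_lim sigma_F = 0"
proof -
  have "excess 12 (7/10) > excess 12 (18/25)" by (rule excess_12_strict_antimono) auto
  then have lo: "excess_lim (7/10) > 0" using excess_12_pos_18_25 excess_less_lim[of "7/10" 12] by simp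
  have "excess_lim (3/4) \<le> -2/100"
    by (rule LIMSEQ_le_const2[OF excess_tendsto]) (use excess_3_4_bound in auto)
  then have hi: "excess_lim (3/4) < 0" by simp
  have "\<exists>\<sigma>. 7/10 \<le> \<sigma> \<and> \<sigma> \<le> 3/4 \<and> excess_lim \<sigma> = 0"
    using lo hi continuous_on_excess_lim by (intro IVT2') auto
  then obtain \<sigma> where s: "7/10 \<le> \<sigma>" "\<sigma> \<le> 3/4" "excess_lim \<sigma> = 0" by blast
  have "\<sigma> \<noteq> 7/10" "\<sigma> \<noteq> 3/4" using s(3) lo hi by (metis less_irrefl)+
  with s have s': "7/10 < \<sigma>" "\<sigma> < 3/4" by auto
  have uniq: "\<tau> = \<sigma>" if "\<tau> \<in> {7/10<..<3/4}" "excess_lim \<tau> = 0" for \<tau>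
    using excess_lim_strict_antimono[of \<tau> \<sigma>] excess_lim_strict_antimono[of \<sigma> \<tau>] that s s'
    by (cases \<tau> \<sigma> rule: linorder_cases) auto
  have "sigma_F = \<sigma>" unfolding sigma_F_def
  proof (rule the_equality)
    show "\<sigma> \<in> {7/10<..<3/4} \<and> Z_F (of_real \<sigma>) = 4 + 2 * 144 powr (- of_real \<sigma>)"
      using s s' threshold_iff_excess_lim[of \<sigma>] by simp
    fix \<tau> :: real
    assume "\<tau> \<in> {7/10<..<3/4} \<and> Z_F (of_real \<tau>) = 4 + 2 * 144 powr (- of_real \<tau>)"
    then show "\<tau> = \<sigma>" using uniq[of \<tau>] threshold_iff_excess_lim[of \<tau>] by simp
  qed
  then show "sigma_F \<in> {7/10<..<3/4}" "excess_lim sigma_F = 0" using s s' by auto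
qed

text \<open>From above, \<open>excess N sigma_F\<close> lies below the limit value 0. From below,
  the limit excess is positive at any b in [7/10, sigma_F), so \<open>excess N b\<close> is
  eventually positive and \<open>sigma_FN N\<close> exceeds b.\<close>

lemma sigma_FN_tendsto: "sigma_FN \<longlonglongrightarrow> sigma_F"
proof (rule order_tendstoI)
  have sF: "7/10 < sigma_F" "sigma_F < 3/4" "excess_lim sigma_F = 0" using sigma_F_properties by auto
  have lt: "sigma_FN N < sigma_F" if "N \<ge> 12" for N
    using excess_less_lim[of sigma_F N] sF excess_neg_iff(1)[OF that, of sigma_F] by simp
  show "eventually (\<lambda>N. sigma_FN N < a) sequentially" if "a > sigma_F" for a
    using eventually_ge_at_top[of 12] by eventually_elim (use lt that in force)
  show "eventually (\<lambda>N. sigma_FN N > a) sequentially" if "a < sigma_F" for a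
  proof -
    define b where "b = max a (7/10)"
    have b: "b < sigma_F" "b \<ge> 7/10" "b \<ge> a" using that sF by (auto simp: b_def)
    have "excess_lim b > 0" using excess_lim_strict_antimono[of b sigma_F] b sF by simp
    then have "eventually (\<lambda>N. excess N b > 0) sequentially"
      using order_tendstoD(1)[OF excess_tendsto[of b]] b by simp
    then show ?thesis using eventually_ge_at_top[of 12]
      by eventually_elim (use excess_neg_iff(2)[of _ b] b in force)
  qed
qed

section \<open>Twisted sums with a prescribed zero\<close>

lemma unit_direction: "\<exists>u. norm u = 1 \<and> (w::complex) = of_real (norm w) * u"
proof (cases "w = 0")
  case True
  then show ?thesis by (intro exI[of _ 1]) auto
next
  case False
  then show ?thesis by (intro exI[of _ "w / of_real (norm w)"]) (auto simp: norm_divide)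
qed

text \<open>A triangle with sides |w|, b and v. As z turns from the direction of w to the opposite
  one, the distance runs continuously from ||w| - b| to |w| + b, and the hypotheses place v in
  between.\<close>

lemma triangle_with_sides:
  fixes w :: complex
  assumes "0 \<le> v" "0 \<le> b" "\<bar>v - b\<bar> \<le> norm w" "norm w \<le> v + b"
  shows "\<exists>z. norm z = 1 \<and> norm (w - of_real b * z) = v"
proof -
  obtain u where u: "norm u = 1" "w = of_real (norm w) * u" using unit_direction by blast
  define f where "f = (\<lambda>\<theta>. norm (w - of_real b * (u * cis \<theta>)))"
  have "w - of_real b * (u * cis 0) = of_real (norm w - b) * u"
    using u(2) by (simp add: algebra_simps)
  then have "f 0 = \<bar>norm w - b\<bar>" by (simp add: f_def norm_mult u(1) del: of_real_diff)
  then have f0: "f 0 \<le> v" using assms by linarith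
  have "w - of_real b * (u * cis pi) = of_real (norm w + b) * u"
    using u(2) by (simp add: algebra_simps)
  then have "f pi = \<bar>norm w + b\<bar>" by (simp add: f_def norm_mult u(1) del: of_real_add)
  then have fpi: "v \<le> f pi" using assms by linarith
  have "continuous_on {0..pi} f" unfolding f_def by (intro continuous_intros)
  then obtain \<theta> where "f \<theta> = v" using IVT'[of f 0 v pi] f0 fpi by auto
  then show ?thesis unfolding f_def by (intro exI[of _ "u * cis \<theta>"]) (simp add: norm_mult u(1))
qed

text \<open>Vectors are split off one at a time, leaving the smallest remainder v that is still at
  least \<open>a m\<close>. The triangle exists because \<open>a x\<close> <= \<open>a m\<close> <=
  v, and v stays in the annulus of the remaining vectors.\<close>

lemma annulus_subset_unit_combinations:
  fixes w :: complex and a :: "'i \<Rightarrow> real"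
  assumes "finite A" "m \<notin> A" "\<And>n. n \<in> A \<Longrightarrow> 0 \<le> a n \<and> a n \<le> a m" "0 \<le> a m"
    and "a m \<le> norm w" "norm w \<le> a m + (\<Sum>n\<in>A. a n)"
  shows "\<exists>z. (\<forall>n. norm (z n) = 1) \<and> w = (\<Sum>n\<in>insert m A. of_real (a n) * z n)"
  using assms
proof (induction A arbitrary: w rule: finite_induct)
  case empty
  obtain u where u: "norm u = 1" "w = of_real (norm w) * u" using unit_direction by blast
  then show ?case using empty by (intro exI[of _ "\<lambda>_. u"]) auto
next
  case (insert x A)
  have ax: "0 \<le> a x" "a x \<le> a m" using insert.prems by auto
  define v where "v = max (a m) (norm w - a x)"
  have v: "v \<ge> a m" "v \<ge> norm w - a x" "v = a m \<or> v = norm w - a x" by (auto simp: v_def max_def)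
  have sumx: "(\<Sum>n\<in>insert x A. a n) = a x + (\<Sum>n\<in>A. a n)" using insert.hyps by simp
  have sumA: "(\<Sum>n\<in>A. a n) \<ge> 0" using insert.prems by (intro sum_nonneg) auto
  have "\<exists>z. norm z = 1 \<and> norm (w - of_real (a x) * z) = v"
    by (rule triangle_with_sides) (use ax v insert.prems(3,4) in linarith)+
  then obtain z0 where z0: "norm z0 = 1" "norm (w - of_real (a x) * z0) = v" by blast
  have "\<exists>z. (\<forall>n. norm (z n) = 1) \<and> w - of_real (a x) * z0 = (\<Sum>n\<in>insert m A. of_real (a n) * z n)"
  proof (rule insert.IH)
    show "a m \<le> norm (w - of_real (a x) * z0)" using z0 v by simp
    show "norm (w - of_real (a x) * z0) \<le> a m + (\<Sum>n\<in>A. a n)"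
      using z0(2) v(3) insert.prems(5) sumA unfolding sumx by linarith
  qed (use insert.prems in auto)
  then obtain z where z: "\<And>n. norm (z n) = 1" "w - of_real (a x) * z0 = (\<Sum>n\<in>insert m A. of_real (a n) * z n)"
    by blast
  have xm: "x \<notin> insert m A" using insert by auto
  have "(\<Sum>n\<in>insert m (insert x A). of_real (a n) * (z(x := z0)) n)
      = of_real (a x) * z0 + (\<Sum>n\<in>insert m A. of_real (a n) * (z(x := z0)) n)"
    using xm insert.hyps by (subst insert_commute, subst sum.insert) auto
  also have "(\<Sum>n\<in>insert m A. of_real (a n) * (z(x := z0)) n) = (\<Sum>n\<in>insert m A. of_real (a n) * z n)"
    using xm by (intro sum.cong) auto
  also have "of_real (a x) * z0 + \<dots> = w" using z(2) by (metis add.commute diff_add_cancel)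
  finally show ?case using z(1) z0(1) by (intro exI[of _ "z(x := z0)"]) auto
qed

text \<open>One more vector closes the hole of the annulus. It is the longest, but no longer than
  the others together; the remainder of length at least \<open>a x\<close> then falls into the
  annulus.\<close>

lemma disc_subset_unit_combinations:
  fixes w :: complex and a :: "'i \<Rightarrow> real"
  assumes "finite A" "m \<notin> A" "\<And>n. n \<in> A \<Longrightarrow> 0 \<le> a n \<and> a n \<le> a m" "0 \<le> a m"
    and "x \<notin> insert m A" "a m \<le> a x" "a x \<le> a m + (\<Sum>n\<in>A. a n)"
    and "norm w \<le> a x + (a m + (\<Sum>n\<in>A. a n))"
  shows "\<exists>z. (\<forall>n. norm (z n) = 1) \<and> w = (\<Sum>n\<in>insert x (insert m A). of_real (a n) * z n)"
proof -
  define v where "v = max (a x) (norm w - a x)"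
  have v: "v \<ge> a x" "v \<ge> norm w - a x" "v = a x \<or> v = norm w - a x" by (auto simp: v_def max_def)
  have "\<exists>z. norm z = 1 \<and> norm (w - of_real (a x) * z) = v"
    by (rule triangle_with_sides) (use v assms(4,6) norm_ge_zero[of w] in linarith)+
  then obtain z0 where z0: "norm z0 = 1" "norm (w - of_real (a x) * z0) = v" by blast
  have "\<exists>z. (\<forall>n. norm (z n) = 1) \<and> w - of_real (a x) * z0 = (\<Sum>n\<in>insert m A. of_real (a n) * z n)"
  proof (rule annulus_subset_unit_combinations)
    show "a m \<le> norm (w - of_real (a x) * z0)" using z0(2) v(1) assms(6) by linarith
    show "norm (w - of_real (a x) * z0) \<le> a m + (\<Sum>n\<in>A. a n)"
      using z0(2) v(3) assms(7,8) by linarith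
  qed (use assms in auto)
  then obtain z where z: "\<And>n. norm (z n) = 1" "w - of_real (a x) * z0 = (\<Sum>n\<in>insert m A. of_real (a n) * z n)"
    by blast
  have "(\<Sum>n\<in>insert x (insert m A). of_real (a n) * (z(x := z0)) n)
      = of_real (a x) * z0 + (\<Sum>n\<in>insert m A. of_real (a n) * (z(x := z0)) n)"
    using assms by (subst sum.insert) auto
  also have "(\<Sum>n\<in>insert m A. of_real (a n) * (z(x := z0)) n) = (\<Sum>n\<in>insert m A. of_real (a n) * z n)"
    using assms by (intro sum.cong) auto
  also have "of_real (a x) * z0 + \<dots> = w" using z(2) by (metis add.commute diff_add_cancel)
  finally show ?thesis using z(1) z0(1) by (intro exI[of _ "z(x := z0)"]) auto
qed

text \<open>The polygon inequality for the free terms, whose longest is 5^(-\<sigma>). After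
  division by it the right side decreases in \<sigma>, so the value at 3/4 suffices: 0.48 + 0.34 +
  0.23 > 1. Indices up to 9 are present for every N >= 12.\<close>

lemma fib_wt_5_le:
  assumes "0 \<le> \<sigma>" "\<sigma> \<le> 3/4"
  shows "fib_wt 5 \<sigma> \<le> fib_wt 7 \<sigma> + fib_wt 8 \<sigma> + fib_wt 9 \<sigma>"
proof -
  have lo: "c \<le> x powr (-\<sigma>)" if "x > 0" "c > 0" "c ^ 4 * x ^ 3 \<le> 1" "x \<ge> 1" for x c :: real
  proof -
    have "c \<le> x powr (-(3/4))" using le_powr_minusI[of x c 4 3] that by simp
    also have "\<dots> \<le> x powr (-\<sigma>)" using assms that by (intro powr_mono) auto
    finally show ?thesis .
  qed
  have r: "fib_wt n \<sigma> = fib_wt 5 \<sigma> * (real (fib n) / 5) powr (-\<sigma>)" for n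
  proof -
    have "real (fib n) powr (-\<sigma>) = (5 * (real (fib n) / 5)) powr (-\<sigma>)" by simp
    also have "\<dots> = 5 powr (-\<sigma>) * (real (fib n) / 5) powr (-\<sigma>)" by (rule powr_mult)
    finally show ?thesis by (simp add: fib_wt_def fib_vals)
  qed
  have "48/100 \<le> (13/5::real) powr (-\<sigma>)" "34/100 \<le> (21/5::real) powr (-\<sigma>)" "23/100 \<le> (34/5::real) powr (-\<sigma>)"
    by (rule lo; simp add: power_divide)+
  then have "1 \<le> (13/5::real) powr (-\<sigma>) + (21/5::real) powr (-\<sigma>) + (34/5::real) powr (-\<sigma>)" by simp
  then have "fib_wt 5 \<sigma> * 1 \<le> fib_wt 5 \<sigma> * ((13/5::real) powr (-\<sigma>) + (21/5::real) powr (-\<sigma>) + (34/5::real) powr (-\<sigma>))"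
    using fib_wt_pos[of 5 \<sigma>] by (intro mult_left_mono) auto
  then show ?thesis using r[of 7] r[of 8] r[of 9] by (simp add: fib_vals algebra_simps)
qed

text \<open>
  The phases at the primes \<open>2\<close> and \<open>3\<close> are fixed to \<open>-1\<close>, which forces \<open>-1\<close> at \<open>8 = 2\<^sup>3\<close> and \<open>1\<close> at
  \<open>144 = 2\<^sup>4 3\<^sup>2\<close>. The remaining phases are free and their sums fill a disc.
\<close>
lemma twisted_zero:
  assumes N: "N \<ge> 12" and s: "0 < \<sigma>" "\<sigma> < sigma_FN N"
  shows "\<exists>\<xi>. (\<forall>n. norm (\<xi> n) = 1) \<and> \<xi> 1 = 1 \<and> \<xi> 2 = 1 \<and> \<xi> 6 = \<xi> 3 ^ 3 \<and>
    \<xi> 12 = \<xi> 3 ^ 4 * \<xi> 4 ^ 2 \<and> (\<Sum>n=1..N. complex_of_real (fib_wt n \<sigma>) * \<xi> n) = 0"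
proof -
  have s34: "\<sigma> < 3/4" using s sigma_FN_exists(2)[OF N] by simp
  define a where "a = (\<lambda>n. fib_wt n \<sigma>)"
  define A where "A = {8..N} - {12}"
  define D where "D = {1,2,3,4,6,12::nat}"
  have dec: "{1..N} = D \<union> insert 5 (insert 7 A)" "D \<inter> insert 5 (insert 7 A) = {}"
    using N by (auto simp: A_def D_def)
  have finA: "finite A" "finite D" by (auto simp: A_def D_def)
  have pos: "a n > 0" if "n > 0" for n using that by (simp add: a_def fib_wt_pos)
  have mono: "a n \<le> a m" if "0 < m" "m \<le> n" for m n
    using that s by (simp add: a_def fib_wt_mono_index)
  have a12: "a 1 = 1" "a (Suc 0) = 1" "a 2 = 1" by (simp_all add: a_def fib_wt_def)
  have "a 8 + a 9 = (\<Sum>n\<in>{8,9}. a n)" by simp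
  also have "\<dots> \<le> (\<Sum>n\<in>A. a n)"
    using N finA pos by (intro sum_mono2) (auto simp: A_def less_imp_le)
  finally have big: "a 5 \<le> a 7 + (\<Sum>n\<in>A. a n)"
    using fib_wt_5_le[of \<sigma>] s s34 by (simp add: a_def)
  define c where "c = 2 - a 3 - a 4 - a 6 + a 12"
  \<comment> \<open>\<open>c\<close> is the contribution of the fixed phases. The excess is exactly
    the total of the free weights minus \<open>c\<close>, so its positivity is what puts
    \<open>- c\<close> into the disc.\<close>
  have "excess N \<sigma> = (\<Sum>n\<in>D. a n) + (a 5 + (a 7 + (\<Sum>n\<in>A. a n))) - 4 - 2 * a 12"
  proof -
    have "excess N \<sigma> = (\<Sum>n=1..N. a n) - 4 - 2 * a 12" by (simp add: excess_def a_def)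
    also have "(\<Sum>n=1..N. a n) = (\<Sum>n\<in>D. a n) + (\<Sum>n\<in>insert 5 (insert 7 A). a n)"
      unfolding dec(1) using finA dec(2) by (intro sum.union_disjoint) auto
    also have "(\<Sum>n\<in>insert 5 (insert 7 A). a n) = a 5 + (a 7 + (\<Sum>n\<in>A. a n))"
      using finA by (simp add: A_def)
    finally show ?thesis .
  qed
  also have "(\<Sum>n\<in>D. a n) = 2 + a 3 + a 4 + a 6 + a 12" by (simp add: D_def a12)
  finally have "c \<le> a 5 + (a 7 + (\<Sum>n\<in>A. a n))"
    using excess_pos[OF N s] by (simp add: c_def)
  moreover have "- c \<le> a 5 + (a 7 + (\<Sum>n\<in>A. a n))"
  proof -
    have "a 3 \<le> 1" "a 4 \<le> 1" "a 6 \<le> a 5" using mono[of 1 3] mono[of 1 4] mono[of 5 6] a12 by simp_all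
    moreover have "(\<Sum>n\<in>A. a n) \<ge> 0" using pos by (intro sum_nonneg) (auto simp: A_def less_imp_le)
    moreover have "a 12 > 0" "a 7 > 0" using pos by auto
    ultimately show ?thesis unfolding c_def by linarith
  qed
  ultimately have "norm (of_real (- c) :: complex) \<le> a 5 + (a 7 + (\<Sum>n\<in>A. a n))" by simp
  then have "\<exists>z. (\<forall>n. norm (z n) = 1) \<and> complex_of_real (- c) = (\<Sum>n\<in>insert 5 (insert 7 A). of_real (a n) * z n)"
    using big by (intro disc_subset_unit_combinations) (auto simp: A_def pos less_imp_le mono)
  then obtain z where z: "\<And>n. norm (z n) = 1"
    "complex_of_real (- c) = (\<Sum>n\<in>insert 5 (insert 7 A). of_real (a n) * z n)" by blast
  define \<xi> where "\<xi> = (\<lambda>n. if n \<in> {1,2,12} then 1 else if n \<in> {3,4,6} then -1 else z n)"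
  have "(\<Sum>n=1..N. of_real (a n) * \<xi> n) = (\<Sum>n\<in>D. of_real (a n) * \<xi> n)
      + (\<Sum>n\<in>insert 5 (insert 7 A). of_real (a n) * \<xi> n)"
    unfolding dec(1) using finA dec(2) by (intro sum.union_disjoint) auto
  also have "(\<Sum>n\<in>insert 5 (insert 7 A). of_real (a n) * \<xi> n) = of_real (- c)"
    unfolding z(2) by (intro sum.cong) (auto simp: \<xi>_def A_def)
  also have "(\<Sum>n\<in>D. of_real (a n) * \<xi> n) = of_real c"
    by (simp add: D_def \<xi>_def c_def a12)
  finally have "(\<Sum>n=1..N. of_real (a n) * \<xi> n) = 0" by simp
  then show ?thesis by (intro exI[of _ \<xi>]) (auto simp: \<xi>_def z(1) a_def)
qed

section \<open>The zero-free half-plane\<close>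

lemma fib_powr_eq:
  assumes "n > 0"
  shows "of_nat (fib n) powr (- s) = of_real (fib_wt n (Re s)) * cis (- Im s * ln (real (fib n)))"
proof -
  have l: "Ln (of_nat (fib n)) = of_real (ln (real (fib n)))" using assms by (simp add: Ln_of_nat)
  have "of_nat (fib n) powr (- s) = exp (- s * of_real (ln (real (fib n))))"
    using assms by (simp add: powr_def l)
  also have "\<dots> = of_real (exp (- Re s * ln (real (fib n)))) * cis (- Im s * ln (real (fib n)))"
    by (simp add: exp_eq_polar)
  also have "exp (- Re s * ln (real (fib n))) = fib_wt n (Re s)"
    using assms by (simp add: fib_wt_def powr_def)
  finally show ?thesis .
qed

lemma Re_Z_FN: "Re (Z_FN N s) = (\<Sum>n=1..N. fib_wt n (Re s) * cos (Im s * ln (real (fib n))))"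
  unfolding Z_FN_def Re_sum by (intro sum.cong refl) (simp add: fib_powr_eq)

text \<open>
  At \<open>A = B = \<pi>\<close> both sides vanish: moving away from the phases \<open>-1\<close> at \<open>2\<close> and \<open>3\<close> costs more
  than can be gained at \<open>144\<close>.
\<close>
lemma cos_trade_off:
  fixes a b d A B :: real
  assumes "a > 0" "b > 0" "d \<ge> 0" "16 * (d / a) + 4 * (d / b) \<le> 1"
  shows "d * (1 - cos (4 * A + 2 * B)) \<le> a * (1 + cos A) + b * (1 + cos B)"
proof -
  define p where "p = \<bar>sin A\<bar>"
  define q where "q = \<bar>sin B\<bar>"
  have half: "(sin x)\<^sup>2 \<le> 2 * (1 + cos x)" for x :: real
  proof -
    have "(sin x)\<^sup>2 = (1 - cos x) * (1 + cos x)" 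
      using sin_squared_eq[of x] by (simp add: algebra_simps power2_eq_square)
    also have "\<dots> \<le> 2 * (1 + cos x)"
      using cos_ge_minus_one[of x] by (intro mult_right_mono) linarith+
    finally show ?thesis .
  qed
  have "\<bar>sin (2 * A + B)\<bar> \<le> \<bar>sin (2 * A)\<bar> * \<bar>cos B\<bar> + \<bar>cos (2 * A)\<bar> * \<bar>sin B\<bar>"
    unfolding sin_add abs_mult[symmetric] by (rule abs_triangle_ineq)
  also have "\<dots> \<le> \<bar>sin (2 * A)\<bar> * 1 + 1 * \<bar>sin B\<bar>"
    by (intro add_mono mult_mono) auto
  also have "\<bar>sin (2 * A)\<bar> \<le> 2 * p * 1"
    unfolding sin_double abs_mult p_def by (intro mult_mono) auto
  finally have "\<bar>sin (2 * A + B)\<bar> \<le> 2 * p + q" by (simp add: q_def)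
  then have "\<bar>sin (2 * A + B)\<bar>\<^sup>2 \<le> (2 * p + q)\<^sup>2" by (intro power_mono) auto
  then have "(sin (2 * A + B))\<^sup>2 \<le> (2 * p + q)\<^sup>2" by simp
  moreover have "1 - cos (4 * A + 2 * B) = 2 * (sin (2 * A + B))\<^sup>2"
    using cos_double_sin[of "2 * A + B"] by (simp add: algebra_simps)
  ultimately have 1: "d * (1 - cos (4 * A + 2 * B)) \<le> d * (2 * (2 * p + q)\<^sup>2)"
    using assms(3) by (intro mult_left_mono) auto
  \<comment> \<open>Cauchy-Schwarz in explicit form: (2 p + q)^2 <= (4/a + 1/b) (a p^2 + b
    q^2).\<close>
  have "0 \<le> (a * p - 2 * b * q)\<^sup>2 / (a * b)" using assms by simp
  also have "\<dots> = (4 / a + 1 / b) * (a * p\<^sup>2 + b * q\<^sup>2) - (2 * p + q)\<^sup>2"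
    using assms by (simp add: field_simps power2_eq_square)
  finally have "d * (2 * (2 * p + q)\<^sup>2) \<le> d * (2 * ((4 / a + 1 / b) * (a * p\<^sup>2 + b * q\<^sup>2)))"
    using assms(3) by (intro mult_left_mono) auto
  also have "\<dots> = (16 * (d / a) + 4 * (d / b)) * ((a * p\<^sup>2 + b * q\<^sup>2) / 2)"
    by (simp add: algebra_simps add_divide_distrib)
  also have "\<dots> \<le> 1 * ((a * p\<^sup>2 + b * q\<^sup>2) / 2)"
    using assms by (intro mult_right_mono) auto
  also have "\<dots> \<le> (a * (2 * (1 + cos A)) + b * (2 * (1 + cos B))) / 2"
    using half[of A] half[of B] assms by (auto simp: p_def q_def intro!: add_mono mult_left_mono divide_right_mono)
  finally show ?thesis using 1 by (simp add: algebra_simps)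
qed

text \<open>The ratios are 72^(-\<sigma>) and 48^(-\<sigma>), both decreasing, so 18/25 is the worst
  case: 16 * 0.0460 + 4 * 0.0616 = 0.9824.\<close>

lemma fib_wt_12_trade_off:
  assumes "\<sigma> \<ge> 18/25"
  shows "16 * (fib_wt 12 \<sigma> / fib_wt 3 \<sigma>) + 4 * (fib_wt 12 \<sigma> / fib_wt 4 \<sigma>) \<le> 1"
proof -
  have hi: "x powr (-\<sigma>) \<le> c" if "x \<ge> 1" "c > 0" "c ^ 25 * x ^ 18 \<ge> 1" for x c :: real
  proof -
    have "x powr (-\<sigma>) \<le> x powr (-(18/25))" using assms that by (intro powr_mono) auto
    also have "\<dots> \<le> c" using powr_minus_leI[of x c 25 18] that by simp
    finally show ?thesis .
  qed
  have "fib_wt 12 \<sigma> / fib_wt 3 \<sigma> = 72 powr (-\<sigma>)"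
    unfolding fib_wt_def fib_vals using powr_divide[of 144 2 "-\<sigma>"] by simp
  moreover have "72 powr (-\<sigma>) \<le> 460/10000" by (rule hi) (simp_all add: power_divide)
  moreover have "fib_wt 12 \<sigma> / fib_wt 4 \<sigma> = 48 powr (-\<sigma>)"
    unfolding fib_wt_def fib_vals using powr_divide[of 144 3 "-\<sigma>"] by simp
  moreover have "48 powr (-\<sigma>) \<le> 616/10000" by (rule hi) (simp_all add: power_divide)
  ultimately show ?thesis by simp
qed

lemma ln_144_eq: "ln (144::real) = 4 * ln 2 + 2 * ln 3"
proof -
  have "ln (144::real) = ln (2 ^ 4 * 3 ^ 2)" by simp
  also have "\<dots> = ln (2 ^ 4) + ln (3 ^ 2)" by (subst ln_mult) auto
  also have "\<dots> = 4 * ln 2 + 2 * ln 3" by (simp only: ln_realpow zero_less_numeral of_nat_numeral)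
  finally show ?thesis .
qed

lemma Z_FN_nonzero:
  assumes N: "N \<ge> 12" and ge: "Re \<rho> \<ge> sigma_FN N"
  shows "Z_FN N \<rho> \<noteq> 0"
proof
  assume zero: "Z_FN N \<rho> = 0"
  define \<sigma> where "\<sigma> = Re \<rho>"
  define \<tau> where "\<tau> = Im \<rho>"
  define C where "C = (\<lambda>n. cos (\<tau> * ln (real (fib n))))"
  define a where "a = (\<lambda>n. fib_wt n \<sigma>)"
  have s: "\<sigma> \<ge> 18/25" "\<sigma> \<ge> sigma_FN N" using sigma_FN_exists(2)[OF N] ge by (auto simp: \<sigma>_def)
  have pos: "a n > 0" if "n > 0" for n using that by (simp add: a_def fib_wt_pos)
  have C1: "1 + C n \<ge> 0" for n
    using cos_ge_minus_one[of "\<tau> * ln (real (fib n))"] unfolding C_def by linarith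
  have a12: "a 1 = 1" "a (Suc 0) = 1" "a 2 = 1" "C 1 = 1" "C (Suc 0) = 1" "C 2 = 1"
    by (simp_all add: a_def C_def fib_wt_def)
  have ex: "excess N \<sigma> \<le> 0"
    using excess_neg_iff(2)[OF N, of \<sigma>] s by linarith
  have "(\<Sum>n=1..N. a n * C n) = 0"
    using zero Re_Z_FN[of N \<rho>] by (simp add: a_def C_def \<sigma>_def \<tau>_def)
  then have "(\<Sum>n=1..N. a n * (1 + C n)) = excess N \<sigma> + 4 + 2 * a 12"
    by (simp add: excess_def a_def distrib_left sum.distrib)
  moreover have "(\<Sum>n\<in>{1,2,3,4,5,7,12}. a n * (1 + C n)) \<le> (\<Sum>n=1..N. a n * (1 + C n))"
    using N C1 pos by (intro sum_mono2 mult_nonneg_nonneg less_imp_le[OF pos]) auto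
  moreover have "(\<Sum>n\<in>{1,2,3,4,5,7,12}. a n * (1 + C n)) = 4 + a 3 * (1 + C 3) + a 4 * (1 + C 4)
    + a 5 * (1 + C 5) + a 7 * (1 + C 7) + a 12 * (1 + C 12)" by (simp add: a12)
  moreover have "a 12 * (1 - C 12) \<le> a 3 * (1 + C 3) + a 4 * (1 + C 4)"
  proof -
    have "C 12 = cos (4 * (\<tau> * ln 2) + 2 * (\<tau> * ln 3))"
      by (simp add: C_def fib_vals ln_144_eq algebra_simps)
    then show ?thesis
      using cos_trade_off[of "a 3" "a 4" "a 12" "\<tau> * ln 2" "\<tau> * ln 3"] fib_wt_12_trade_off[OF s(1)] pos
      by (simp add: C_def a_def fib_vals fib_wt_pos less_imp_le)
  qed
  ultimately have le: "a 5 * (1 + C 5) + a 7 * (1 + C 7) \<le> 0"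
    using ex by (simp add: algebra_simps)
  have "a 5 * (1 + C 5) \<ge> 0" "a 7 * (1 + C 7) \<ge> 0" using C1[of 5] C1[of 7] pos[of 5] pos[of 7] by simp_all
  with le have "a 5 * (1 + C 5) = 0" "a 7 * (1 + C 7) = 0" by linarith+
  then have "C 5 = -1" "C 7 = -1" using pos[of 5] pos[of 7] by simp_all
  then obtain k l where kl: "\<tau> * ln (real (fib 5)) = (2 * of_int k + 1) * pi"
    "\<tau> * ln (real (fib 7)) = (2 * of_int l + 1) * pi"
    unfolding C_def cos_eq_minus1 by (auto simp: algebra_simps)
  have "\<tau> \<noteq> 0"
  proof
    assume "\<tau> = 0"
    then have "2 * real_of_int k + 1 = 0" using kl(1) by simp
    then have "real_of_int (2 * k + 1) = 0" by simp
    then have "2 * k + 1 = 0" by (simp only: of_int_eq_0_iff)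
    then show False by presburger
  qed
  \<comment> \<open>Eliminating \<tau> gives a relation between ln 5 and ln 13 with odd, hence
    nonzero, coefficients.\<close>
  have "\<tau> * ((2 * of_int l + 1) * ln (real (fib 5)) - (2 * of_int k + 1) * ln (real (fib 7)))
    = (2 * of_int l + 1) * (\<tau> * ln (real (fib 5))) - (2 * of_int k + 1) * (\<tau> * ln (real (fib 7)))"
    by (simp add: algebra_simps)
  also have "\<dots> = 0" unfolding kl by (simp add: algebra_simps)
  finally have "\<tau> * ((2 * of_int l + 1) * ln (real (fib 5)) - (2 * of_int k + 1) * ln (real (fib 7))) = 0" .
  then have rel: "(2 * of_int l + 1) * ln (real (fib 5)) - (2 * of_int k + 1) * ln (real (fib 7)) = 0"
    using \<open>\<tau> \<noteq> 0\<close> by simp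
  define f where "f = (\<lambda>n::nat. if n = 5 then 2 * l + 1 else - (2 * k + 1))"
  have "f 5 = 0"
  proof (rule ln_fib_independent)
    show "(\<Sum>n\<in>{5,7}. of_int (f n) * ln (real (fib n))) = 0" using rel by (simp add: f_def algebra_simps)
  qed (auto simp: carmichael_indices_def)
  then have "2 * l + 1 = 0" by (simp add: f_def)
  then show False by presburger
qed

section \<open>Density of the real parts of zeros\<close>

definition twisted_sum :: "(nat \<Rightarrow> complex) \<Rightarrow> nat \<Rightarrow> complex \<Rightarrow> complex" where
  "twisted_sum \<xi> N s = (\<Sum>n=1..N. of_nat (fib n) powr (- s) * \<xi> n)"

lemma holomorphic_twisted_sum: "twisted_sum \<xi> N holomorphic_on A"
  unfolding twisted_sum_def by (intro holomorphic_intros) auto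

lemma Z_FN_vertical_shift:
  "Z_FN N (s - \<i> * of_real t) = twisted_sum (\<lambda>n. cis (t * ln (real (fib n)))) N s"
  unfolding Z_FN_def twisted_sum_def
proof (intro sum.cong refl)
  fix n assume "n \<in> {1..N}"
  then have n: "n > 0" by simp
  show "of_nat (fib n) powr (- (s - \<i> * of_real t)) = of_nat (fib n) powr (- s) * cis (t * ln (real (fib n)))"
    unfolding fib_powr_eq[OF n] by (simp add: mult.assoc cis_mult algebra_simps)
qed

lemma norm_fib_powr: "n > 0 \<Longrightarrow> norm (of_nat (fib n) powr (- s) :: complex) = fib_wt n (Re s)"
  by (simp only: fib_powr_eq norm_mult norm_of_real norm_cis) (simp add: fib_wt_pos less_imp_le)

text \<open>Serves to show that the limit function in Hurwitz's theorem is not constant. At s = N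
  the first two terms give 2, and the fewer than N others are at most 2^(-N) each, in total at most
  1.\<close>

lemma twisted_sum_not_zero:
  assumes "N \<ge> 12" "\<And>n. norm (\<xi> n) = 1" "\<xi> 1 = 1" "\<xi> 2 = 1"
  shows "twisted_sum \<xi> N (of_nat N) \<noteq> 0"
proof
  assume z: "twisted_sum \<xi> N (of_nat N) = 0"
  define T where "T = (\<Sum>n\<in>{3..N}. of_nat (fib n) powr (- of_nat N) * \<xi> n)"
  have "{1..N} = {1,2} \<union> {3..N}" using assms(1) by auto
  then have "twisted_sum \<xi> N (of_nat N) = 2 + T"
    unfolding twisted_sum_def T_def using assms by (simp add: sum.union_disjoint)
  then have T: "T = -2" using z by (simp add: eq_neg_iff_add_eq_0 add.commute)
  have "norm T \<le> (\<Sum>n\<in>{3..N}. norm (of_nat (fib n) powr (- of_nat N) * \<xi> n))"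
    unfolding T_def by (rule norm_sum)
  also have "\<dots> = (\<Sum>n\<in>{3..N}. fib_wt n (real N))"
    using assms(2) by (intro sum.cong refl) (simp add: norm_mult norm_fib_powr)
  also have "\<dots> \<le> (\<Sum>n\<in>{3..N}. fib_wt 3 (real N))"
    by (intro sum_mono fib_wt_mono_index) auto
  also have "\<dots> \<le> real N * fib_wt 3 (real N)"
    using fib_wt_pos[of 3 "real N"] by (auto intro: mult_right_mono)
  also have "fib_wt 3 (real N) = 1 / 2 ^ N" by (simp add: fib_wt_def fib_vals powr_minus_divide powr_realpow)
  also have "real N * (1 / 2 ^ N) \<le> 1"
    using of_nat_less_two_power[of N, where 'a=real] by (simp add: less_imp_le)
  finally show False by (simp add: T)
qed

lemma zeros_near:
  assumes N: "N \<ge> 12" and s: "0 < \<sigma>" "\<sigma> < sigma_FN N" and e: "0 < \<epsilon>" "\<epsilon> \<le> \<sigma>"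
  shows "\<exists>\<rho>. Z_FN N \<rho> = 0 \<and> \<bar>Re \<rho> - \<sigma>\<bar> < \<epsilon>"
proof (rule ccontr)
  assume contra: "\<nexists>\<rho>. Z_FN N \<rho> = 0 \<and> \<bar>Re \<rho> - \<sigma>\<bar> < \<epsilon>"
  obtain \<xi> :: "nat \<Rightarrow> complex" where \<xi>: "\<And>n. norm (\<xi> n) = 1" "\<xi> 1 = 1" "\<xi> 2 = 1"
    "\<xi> 6 = \<xi> 3 ^ 3" "\<xi> 12 = \<xi> 3 ^ 4 * \<xi> 4 ^ 2" "(\<Sum>n=1..N. of_real (fib_wt n \<sigma>) * \<xi> n) = 0"
    using twisted_zero[OF N s] by blast
  have c3: "3 \<in> {3..N} \<inter> carmichael_indices" "4 \<in> {3..N} \<inter> carmichael_indices"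
    using N by (auto simp: carmichael_indices_def)
  obtain t where t: "\<And>n. n \<in> {3..N} \<inter> carmichael_indices \<Longrightarrow> (\<lambda>k. cis (t k * ln (real (fib n)))) \<longlonglongrightarrow> \<xi> n"
    by (rule Kronecker_fib[of "{3..N} \<inter> carmichael_indices" \<xi>]) (use \<xi>(1) in auto)
  \<comment> \<open>Kronecker's theorem does not cover indices 6 and 12. Their phases converge
    because 8 = 2^3 and 144 = 2^4 3^2, and \<xi> obeys the same relations.\<close>
  have lim: "(\<lambda>k. cis (t k * ln (real (fib n)))) \<longlonglongrightarrow> \<xi> n" if n: "n \<in> {1..N}" for n
  proof -
    have "n = 1 \<or> n = 2 \<or> n = 6 \<or> n = 12 \<or> 3 \<le> n \<and> n \<noteq> 6 \<and> n \<noteq> 12" using n by auto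
    then have "n = 1 \<or> n = 2 \<or> n = 6 \<or> n = 12 \<or> n \<in> {3..N} \<inter> carmichael_indices"
      using n by (auto simp: carmichael_indices_def)
    then
    consider "n = 1" | "n = 2" | "n = 6" | "n = 12" | "n \<in> {3..N} \<inter> carmichael_indices"
      by blast
    then show ?thesis
    proof cases
      case 3
      have "ln (8::real) = 3 * ln 2" using ln_realpow[of 2 3] by simp
      then have "cis (t k * ln (real (fib n))) = cis (t k * ln (real (fib 3))) ^ 3" for k
        by (simp add: 3 fib_vals Complex.DeMoivre mult_ac)
      moreover have "(\<lambda>k. cis (t k * ln (real (fib 3))) ^ 3) \<longlonglongrightarrow> \<xi> 3 ^ 3"
        by (intro tendsto_intros t c3)
      ultimately show ?thesis using 3 \<xi>(4) by simp
    next
      case 4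
      have "cis (t k * ln (real (fib n))) = cis (t k * ln (real (fib 3))) ^ 4 * cis (t k * ln (real (fib 4))) ^ 2" for k
        by (simp add: 4 fib_vals Complex.DeMoivre cis_mult ln_144_eq algebra_simps)
      moreover have "(\<lambda>k. cis (t k * ln (real (fib 3))) ^ 4 * cis (t k * ln (real (fib 4))) ^ 2) \<longlonglongrightarrow> \<xi> 3 ^ 4 * \<xi> 4 ^ 2"
        by (intro tendsto_intros t c3)
      ultimately show ?thesis using 4 \<xi>(5) by simp
    qed (use \<xi>(2,3) t in auto)
  qed
  define S where "S = {s. \<bar>Re s - \<sigma>\<bar> < \<epsilon>}"
  have S': "S = {s. \<sigma> - \<epsilon> < Re s} \<inter> {s. Re s < \<sigma> + \<epsilon>}" by (auto simp: S_def abs_less_iff)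
  have "open S" unfolding S' by (intro open_Int open_halfspace_Re_gt open_halfspace_Re_lt)
  have "connected S" unfolding S'
    by (intro convex_connected convex_Int convex_halfspace_Re_gt convex_halfspace_Re_lt)
  have sS: "of_real \<sigma> \<in> S" using e by (simp add: S_def)
  define F where "F = (\<lambda>k. twisted_sum (\<lambda>n. cis (t k * ln (real (fib n)))) N)"
  \<comment> \<open>Since \<epsilon> <= \<sigma>, the strip lies in Re s >= 0, where all weights are
    at most 1. So convergence of the phases gives uniform convergence on the whole unbounded
    strip.\<close>
  have unif: "uniform_limit S F (twisted_sum \<xi> N) sequentially"
  proof (rule uniform_limitI)
    fix d :: real assume "d > 0"
    define D where "D = (\<lambda>k. \<Sum>n=1..N. norm (cis (t k * ln (real (fib n))) - \<xi> n))"
    have "D \<longlonglongrightarrow> (\<Sum>n=1..N. norm (\<xi> n - \<xi> n))"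
      unfolding D_def by (intro tendsto_intros lim)
    then have "D \<longlonglongrightarrow> 0" by simp
    then have "eventually (\<lambda>k. D k < d) sequentially" using \<open>d > 0\<close> by (rule order_tendstoD(2))
    then show "eventually (\<lambda>k. \<forall>s\<in>S. dist (F k s) (twisted_sum \<xi> N s) < d) sequentially"
    proof eventually_elim
      case (elim k)
      show ?case
      proof
        fix s assume "s \<in> S"
        then have "Re s \<ge> 0" using e by (auto simp: S_def abs_less_iff)
        have "dist (F k s) (twisted_sum \<xi> N s) =
          norm (\<Sum>n=1..N. of_nat (fib n) powr (- s) * (cis (t k * ln (real (fib n))) - \<xi> n))"
          by (simp add: F_def twisted_sum_def dist_norm right_diff_distrib sum_subtractf)
        also have "\<dots> \<le> D k" unfolding D_def
        proof (rule sum_norm_le)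
          fix n assume "n \<in> {1..N}"
          then have n: "n > 0" by simp
          have "fib_wt n (Re s) \<le> fib_wt n 0" using n \<open>Re s \<ge> 0\<close> by (rule fib_wt_antimono)
          also have "\<dots> = 1" using n by (simp add: fib_wt_def)
          finally have "fib_wt n (Re s) \<le> 1" .
          then have "fib_wt n (Re s) * norm (cis (t k * ln (real (fib n))) - \<xi> n) \<le> 1 * norm (cis (t k * ln (real (fib n))) - \<xi> n)"
            by (intro mult_right_mono) auto
          then show "norm (of_nat (fib n) powr (- s) * (cis (t k * ln (real (fib n))) - \<xi> n)) \<le> norm (cis (t k * ln (real (fib n))) - \<xi> n)"
            by (simp add: norm_mult norm_fib_powr[OF n])
        qed
        finally show "dist (F k s) (twisted_sum \<xi> N s) < d" using elim by simp
      qed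
    qed
  qed
  have zero: "twisted_sum \<xi> N (of_real \<sigma>) = 0"
    unfolding twisted_sum_def using \<xi>(6) by (subst sum.cong[OF refl, of _ _ "\<lambda>n. of_real (fib_wt n \<sigma>) * \<xi> n"]) (auto simp: fib_powr_eq)
  \<comment> \<open>A constant limit would vanish on the strip, hence everywhere by analytic
    continuation.\<close>
  have nonconst: "\<not> twisted_sum \<xi> N constant_on S"
  proof
    assume "twisted_sum \<xi> N constant_on S"
    then have 0: "twisted_sum \<xi> N s = 0" if "s \<in> S" for s
      using zero sS that unfolding constant_on_def by metis
    have "twisted_sum \<xi> N (of_nat N) = (\<lambda>_. 0) (of_nat N)"
    proof (rule analytic_continuation_open[of S UNIV "twisted_sum \<xi> N" "\<lambda>_. 0"])
      show "open S" "S \<noteq> {}" using \<open>open S\<close> sS by auto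
      show "twisted_sum \<xi> N s = (\<lambda>_. 0) s" if "s \<in> S" for s using 0[OF that] .
      show "connected (UNIV :: complex set)" by (intro convex_connected convex_UNIV)
      show "twisted_sum \<xi> N holomorphic_on UNIV" by (rule holomorphic_twisted_sum)
    qed simp_all
    then show False using twisted_sum_not_zero[OF N \<xi>(1-3)] by simp
  qed
  have "twisted_sum \<xi> N (of_real \<sigma>) \<noteq> 0"
  proof (rule Hurwitz_no_zeros[of S F "twisted_sum \<xi> N"])
    show "F k holomorphic_on S" for k unfolding F_def by (rule holomorphic_twisted_sum)
    show "uniform_limit K F (twisted_sum \<xi> N) sequentially" if "K \<subseteq> S" for K
      using unif that by (rule uniform_limit_on_subset)
    \<comment> \<open>The strip is invariant under vertical shifts, so a zero of \<open>F k\<close>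
      in it would give one of \<open>Z_FN N\<close> in it.\<close>
    show "F k s \<noteq> 0" if "s \<in> S" for k s
      using contra that unfolding F_def Z_FN_vertical_shift[symmetric] S_def by auto
  qed (use \<open>open S\<close> \<open>connected S\<close> sS nonconst holomorphic_twisted_sum in auto)
  with zero show False by simp
qed

lemma R_FN_subset: "N \<ge> 12 \<Longrightarrow> R_FN N \<subseteq> {0<..<sigma_FN N}"
proof
  fix x assume N: "N \<ge> 12" and "x \<in> R_FN N"
  then obtain \<rho> where \<rho>: "x = Re \<rho>" "Z_FN N \<rho> = 0" "Re \<rho> > 0" by (auto simp: R_FN_def)
  then have "\<not> Re \<rho> \<ge> sigma_FN N" using Z_FN_nonzero[OF N] by blast
  then show "x \<in> {0<..<sigma_FN N}" using \<rho> by simp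
qed

lemma closure_R_FN:
  assumes N: "N \<ge> 12"
  shows "closure (R_FN N) = {0..sigma_FN N}"
proof
  have s: "0 < sigma_FN N" using sigma_FN_exists(2)[OF N] by simp
  have "R_FN N \<subseteq> {0..sigma_FN N}" using R_FN_subset[OF N] by auto
  then show "closure (R_FN N) \<subseteq> {0..sigma_FN N}" by (intro closure_minimal) auto
  have "{0<..<sigma_FN N} \<subseteq> closure (R_FN N)"
  proof
    fix \<sigma> assume \<sigma>: "\<sigma> \<in> {0<..<sigma_FN N}"
    show "\<sigma> \<in> closure (R_FN N)" unfolding closure_approachable
    proof (intro allI impI)
      fix \<epsilon> :: real assume "\<epsilon> > 0"
      \<comment> \<open>A distance below \<sigma> also ensures Re \<rho> > 0, as membership in
        \<open>R_FN N\<close> requires.\<close>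
      then obtain \<rho> where "Z_FN N \<rho> = 0" "\<bar>Re \<rho> - \<sigma>\<bar> < min \<epsilon> \<sigma>"
        using zeros_near[OF N, of \<sigma> "min \<epsilon> \<sigma>"] \<sigma> by auto
      then show "\<exists>y\<in>R_FN N. dist y \<sigma> < \<epsilon>"
        by (intro bexI[of _ "Re \<rho>"]) (auto simp: R_FN_def dist_real_def)
    qed
  qed
  then have "closure {0<..<sigma_FN N} \<subseteq> closure (R_FN N)" by (intro closure_minimal) auto
  then show "{0..sigma_FN N} \<subseteq> closure (R_FN N)" using s by simp
qed

lemma Sup_R_FN:
  assumes N: "N \<ge> 12"
  shows "Sup (R_FN N) = sigma_FN N"
proof (rule cSup_eq_non_empty)
  have s: "0 < sigma_FN N" using sigma_FN_exists(2)[OF N] by simp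
  show "R_FN N \<noteq> {}"
  proof
    assume "R_FN N = {}"
    then have "{0..sigma_FN N} = {}" using closure_R_FN[OF N] by simp
    then show False using s by simp
  qed
  show "x \<le> sigma_FN N" if "x \<in> R_FN N" for x using R_FN_subset[OF N] that by auto
  show "sigma_FN N \<le> y" if "\<And>x. x \<in> R_FN N \<Longrightarrow> x \<le> y" for y
  proof -
    have "closure (R_FN N) \<subseteq> {..y}" using that by (intro closure_minimal) auto
    then have "{0..sigma_FN N} \<subseteq> {..y}" unfolding closure_R_FN[OF N] .
    moreover have "sigma_FN N \<in> {0..sigma_FN N}" using s by simp
    ultimately show ?thesis by blast
  qed
qed

theorem theorem8p1:
  "(\<forall>N\<ge>12.
      (\<exists>!\<sigma>. \<sigma> \<in> {1/2<..<3/4} \<and>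
         Z_FN N (of_real \<sigma>) = 4 + 2 * 144 powr (- of_real \<sigma>)) \<and>
      closure (R_FN N) = {0..sigma_FN N} \<and>
      Sup (R_FN N) = sigma_FN N \<and>
      (\<forall>\<rho>. Re \<rho> = sigma_FN N \<longrightarrow> Z_FN N \<rho> \<noteq> 0)) \<and>
   strict_mono_on {12..} sigma_FN \<and>
   sigma_FN \<longlonglongrightarrow> sigma_F"
proof (intro conjI allI impI)
  fix N :: nat assume N: "N \<ge> 12"
  show "\<exists>!\<sigma>. \<sigma> \<in> {1/2<..<3/4} \<and> Z_FN N (of_real \<sigma>) = 4 + 2 * 144 powr (- of_real \<sigma>)"
    using sigma_FN_exists(1)[OF N] unfolding threshold_iff_excess .
  show "closure (R_FN N) = {0..sigma_FN N}" by (rule closure_R_FN[OF N])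
  show "Sup (R_FN N) = sigma_FN N" by (rule Sup_R_FN[OF N])
  show "Z_FN N \<rho> \<noteq> 0" if "Re \<rho> = sigma_FN N" for \<rho>
    by (rule Z_FN_nonzero[OF N]) (simp add: that)
qed (rule strict_mono_sigma_FN sigma_FN_tendsto)+

end
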